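(* Let $n\ge 2$ and let $\Omega\subset\mathbb{R}^n$ be a $BV$-extension domain or a $W^{1,1}$-extension domain. Then there exists a constant $c>0$, depending only on $n$ and on the operator norm of the extension operator, such that for every $x\in\overline{\Omega}$ and $r\in(0,1]$ we have $$|B(x,r)\cap\Omega|\ge c\,r^n.$$
   Context: A domain is a connected open set; $|\cdot|$ is Lebesgue measure and $B(x,r)$ the open ball. For an open set $U\subset\mathbb{R}^n$, $W^{1,1}(U)=\{u\in L^1(U): \nabla u\in L^1(U;\mathbb{R}^n)\}$ with norm $\|u\|_{L^1(U)}+\|\nabla u\|_{L^1(U)}$; $\|Du\|(U)=\sup\{\int_U u\,\mathrm{div}(v)\,dx : v\in C_0^\infty(U;\mathbb{R}^n),\ |v|\le 1\}$; $BV(U)=\{u\in L^1(U): \|Du\|(U)<\infty\}$ with norm $\|u\|_{L^1(U)}+\|Du\|(U)$. For $X\in\{W^{1,1},BV\}$, a domain $\Omega\subset\mathbb{R}^n$ is an $X$-extension domain if there exist a (not necessarily linear) extension operator $T\colon X(\Omega)\to X(\mathbb{R}^n)$ and a constant $C>0$ with $Tu|_\Omega=u$ and $\|Tu\|_{X(\mathbb{R}^n)}\le C\|u\|_{X(\Omega)}$ for all $u\in X(\Omega)$. The operator norm $\|T\|$ is the minimal such constant $C$. *)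

theory Defs
  imports "HOL-Analysis.Analysis"
begin

primrec Ck :: "nat \<Rightarrow> ('a::euclidean_space \<Rightarrow> 'b::real_normed_vector) \<Rightarrow> bool" where
  "Ck 0 f \<longleftrightarrow> continuous_on UNIV f"
| "Ck (Suc k) f \<longleftrightarrow> (\<forall>x. f differentiable (at x)) \<and>
     (\<forall>w. Ck k (\<lambda>x. frechet_derivative f (at x) w))"

text \<open>The space of smooth functions with compact support in \<open>U\<close>; its members are
  represented by their extensions by zero to the whole space.\<close>

definition test_functions ::
  "'a::euclidean_space set \<Rightarrow> ('a \<Rightarrow> 'b::real_normed_vector) set" where
  "test_functions U = {\<phi>. (\<forall>k. Ck k \<phi>) \<and>
     compact (closure {x. \<phi> x \<noteq> 0}) \<and> closure {x. \<phi> x \<noteq> 0} \<subseteq> U}"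

definition divergence :: "('a::euclidean_space \<Rightarrow> 'a) \<Rightarrow> 'a \<Rightarrow> real" where
  "divergence v x = (\<Sum>b\<in>Basis. frechet_derivative v (at x) b \<bullet> b)"

text \<open>Elements of \<open>L\<^sup>1(U)\<close>, and hence of \<open>W\<^sup>1\<^sup>,\<^sup>1(U)\<close> and \<open>BV(U)\<close>, are represented by
  functions on the whole space whose values outside \<open>U\<close> are irrelevant.  No quotient is taken:
  two functions that agree almost everywhere on \<open>U\<close> represent the same element.\<close>

definition L1_norm :: "'a::euclidean_space set \<Rightarrow> ('a \<Rightarrow> 'b::euclidean_space) \<Rightarrow> real" where
  "L1_norm U f = (LINT x:U|lebesgue. norm (f x))"

definition is_L1_weak_gradient ::
  "'a::euclidean_space set \<Rightarrow> ('a \<Rightarrow> real) \<Rightarrow> ('a \<Rightarrow> 'a) \<Rightarrow> bool" where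
  "is_L1_weak_gradient U u g \<longleftrightarrow> g absolutely_integrable_on U \<and>
     (\<forall>\<phi>\<in>test_functions U. \<forall>b\<in>Basis.
        (LINT x:U|lebesgue. u x * frechet_derivative \<phi> (at x) b) =
        - (LINT x:U|lebesgue. (g x \<bullet> b) * \<phi> x))"

definition W11 :: "'a::euclidean_space set \<Rightarrow> ('a \<Rightarrow> real) set" where
  "W11 U = {u. u absolutely_integrable_on U \<and> (\<exists>g. is_L1_weak_gradient U u g)}"

text \<open>Weak gradients are unique only up to null sets, so one representative is chosen.\<close>

definition weak_gradient :: "'a::euclidean_space set \<Rightarrow> ('a \<Rightarrow> real) \<Rightarrow> 'a \<Rightarrow> 'a" where
  "weak_gradient U u = (SOME g. is_L1_weak_gradient U u g)"

definition W11_norm :: "'a::euclidean_space set \<Rightarrow> ('a \<Rightarrow> real) \<Rightarrow> real" where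
  "W11_norm U u = L1_norm U u + L1_norm U (weak_gradient U u)"

definition total_variation :: "'a::euclidean_space set \<Rightarrow> ('a \<Rightarrow> real) \<Rightarrow> ereal" where
  "total_variation U u =
     (SUP v\<in>{v \<in> test_functions U. \<forall>x. norm (v x) \<le> 1}.
        ereal (LINT x:U|lebesgue. u x * divergence v x))"

definition BV :: "'a::euclidean_space set \<Rightarrow> ('a \<Rightarrow> real) set" where
  "BV U = {u. u absolutely_integrable_on U \<and> total_variation U u < \<infinity>}"

definition BV_norm :: "'a::euclidean_space set \<Rightarrow> ('a \<Rightarrow> real) \<Rightarrow> real" where
  "BV_norm U u = L1_norm U u + real_of_ereal (total_variation U u)"

text \<open>Below, \<open>X\<close> assigns to an open set a function space on it, and \<open>N\<close> the norm of that space.\<close>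

definition extension_bound ::
  "('a::euclidean_space set \<Rightarrow> ('a \<Rightarrow> real) set) \<Rightarrow> ('a set \<Rightarrow> ('a \<Rightarrow> real) \<Rightarrow> real) \<Rightarrow>
   'a set \<Rightarrow> (('a \<Rightarrow> real) \<Rightarrow> 'a \<Rightarrow> real) \<Rightarrow> real \<Rightarrow> bool" where
  "extension_bound X N \<Omega> T C \<longleftrightarrow> C > 0 \<and> (\<forall>u\<in>X \<Omega>. N UNIV (T u) \<le> C * N \<Omega> u)"

text \<open>The second conjunct says that \<open>T\<close> is well defined on classes of functions modulo equality
  almost everywhere.  Linearity is not required.\<close>

definition extension_operator ::
  "('a::euclidean_space set \<Rightarrow> ('a \<Rightarrow> real) set) \<Rightarrow> ('a set \<Rightarrow> ('a \<Rightarrow> real) \<Rightarrow> real) \<Rightarrow>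
   'a set \<Rightarrow> (('a \<Rightarrow> real) \<Rightarrow> 'a \<Rightarrow> real) \<Rightarrow> bool" where
  "extension_operator X N \<Omega> T \<longleftrightarrow>
     (\<forall>u\<in>X \<Omega>. T u \<in> X UNIV \<and> (AE x in lebesgue. x \<in> \<Omega> \<longrightarrow> T u x = u x)) \<and>
     (\<forall>u\<in>X \<Omega>. \<forall>v\<in>X \<Omega>. (AE x in lebesgue. x \<in> \<Omega> \<longrightarrow> u x = v x) \<longrightarrow>
        (AE x in lebesgue. T u x = T v x)) \<and>
     (\<exists>C. extension_bound X N \<Omega> T C)"

definition extension_domain ::
  "('a::euclidean_space set \<Rightarrow> ('a \<Rightarrow> real) set) \<Rightarrow> ('a set \<Rightarrow> ('a \<Rightarrow> real) \<Rightarrow> real) \<Rightarrow>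
   'a set \<Rightarrow> bool" where
  "extension_domain X N \<Omega> \<longleftrightarrow> open \<Omega> \<and> connected \<Omega> \<and> (\<exists>T. extension_operator X N \<Omega> T)"

text \<open>For nonempty \<open>\<Omega>\<close> the infimum is attained, so it is the minimal admissible constant.\<close>

definition extension_norm ::
  "('a::euclidean_space set \<Rightarrow> ('a \<Rightarrow> real) set) \<Rightarrow> ('a set \<Rightarrow> ('a \<Rightarrow> real) \<Rightarrow> real) \<Rightarrow>
   'a set \<Rightarrow> (('a \<Rightarrow> real) \<Rightarrow> 'a \<Rightarrow> real) \<Rightarrow> real" where
  "extension_norm X N \<Omega> T = Inf {C. extension_bound X N \<Omega> T C}"

end

theory Submission imports Defs begin

text \<open>
  Let \<open>m(s) = |B(x,s) \<inter> \<Omega>|\<close>.  Extend to the whole space a bump function that is at least \<open>1\<close> on \<open>B(x,s)\<close> and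
  lives in \<open>B(x,t)\<close>.  On \<open>\<Omega>\<close> its norm is at most a constant times \<open>m(t)\<close> times a power of \<open>1 / (t - s)\<close>, whereas the
  Sobolev inequality on \<open>\<real>\<^sup>n\<close> bounds the variation of the extension from below by a multiple of
  \<open>m(s)\<^sup>1\<^sup>-\<^sup>1\<^sup>/\<^sup>n\<close>.  Hence \<open>m(s)\<^sup>1\<^sup>-\<^sup>1\<^sup>/\<^sup>n\<close> is controlled by \<open>m(t)\<close> (\<open>extension_growth\<close>).  If \<open>m(r) / r\<^sup>n\<close>
  were too small, iterating this between \<open>r\<close> and \<open>r / 2\<close> would force \<open>m(r / 2) = 0\<close>
  (\<open>de_giorgi_iteration\<close>), which is impossible for \<open>x\<close> in the closure of the open set \<open>\<Omega>\<close>.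

  The Sobolev inequality is needed only for functions that are at least \<open>1\<close> on a bounded open set \<open>E\<close>
  (\<open>isoperimetric_BV\<close>), and it has a short proof by duality.  The Newtonian potential of \<open>E\<close>, the convolution
  of its indicator with \<open>z / |z|\<^sup>n\<close>, is a vector field whose divergence is a constant multiple of the
  indicator, and whose length is at most a multiple of \<open>|E|\<^sup>1\<^sup>/\<^sup>n\<close> (\<open>newton_potential_bound\<close>).  Tested against
  this field, the total variation is at least \<open>|E| / |E|\<^sup>1\<^sup>/\<^sup>n\<close> up to a constant.  Admissible fields are
  smooth and have compact support; therefore the kernel is regularized, the indicator is replaced by
  continuous functions below it, and the field is cut off at infinity.

  Both function spaces are treated at once.  The total variation is at most the norm of any weak gradient
  (\<open>total_variation_le_weak_gradient\<close>), so extensions in \<open>W\<^sup>1\<^sup>,\<^sup>1\<close> have bounded variation.  The norm of the bump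
  function in \<open>W\<^sup>1\<^sup>,\<^sup>1(\<Omega>)\<close> involves an unspecified weak gradient, which is compared with the classical one
  by uniqueness (\<open>weak_gradient_unique\<close>).
\<close>

section \<open>Calculus of functions with continuous derivatives of every order\<close>

lemma Ck_SucI:
  assumes "\<And>x. (f has_derivative f' x) (at x)" and "\<And>w. Ck k (\<lambda>x. f' x w)"
  shows "Ck (Suc k) f"
proof -
  have "frechet_derivative f (at x) = f' x" for x
    using frechet_derivative_at[OF assms(1)] by simp
  then show ?thesis using assms by (auto simp: differentiable_def)
qed

lemma Ck_Suc_has_derivative:
  "Ck (Suc k) f \<Longrightarrow> (f has_derivative frechet_derivative f (at x)) (at x)"
  by (simp add: frechet_derivative_works)

lemma Ck_Suc_imp_Ck: "Ck (Suc k) f \<Longrightarrow> Ck k f"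
proof (induction k arbitrary: f)
  case 0
  then show ?case
    by (auto intro!: differentiable_imp_continuous_on simp: differentiable_on_def
        intro: differentiable_at_withinI)
next
  case (Suc k)
  then show ?case by (metis Ck.simps(2))
qed

lemma Ck_imp_continuous_on: "Ck k f \<Longrightarrow> continuous_on UNIV f"
  by (induction k) (use Ck_Suc_imp_Ck in auto)

lemma Ck_const: "Ck k (\<lambda>x. c)"
proof (induction k arbitrary: c)
  case (Suc k)
  show ?case by (rule Ck_SucI[where f' = "\<lambda>x w. 0"]) (auto intro: Suc)
qed auto

lemma Ck_ident: "Ck k (\<lambda>x. x)"
proof (cases k)
  case (Suc k')
  show ?thesis unfolding Suc by (rule Ck_SucI[where f' = "\<lambda>x w. w"]) (auto intro: Ck_const)
qed auto

lemma Ck_bounded_linear: "bounded_linear L \<Longrightarrow> Ck k f \<Longrightarrow> Ck k (\<lambda>x. L (f x))"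
proof (induction k arbitrary: f)
  case 0
  then show ?case by (simp add: bounded_linear.continuous_on)
next
  case (Suc k)
  show ?case
  proof (rule Ck_SucI)
    show "((\<lambda>x. L (f x)) has_derivative (\<lambda>w. L (frechet_derivative f (at x) w))) (at x)" for x
      using bounded_linear.has_derivative[OF Suc.prems(1) Ck_Suc_has_derivative[OF Suc.prems(2)]] .
  qed (use Suc in auto)
qed

lemma Ck_add: "Ck k f \<Longrightarrow> Ck k g \<Longrightarrow> Ck k (\<lambda>x. f x + g x)"
proof (induction k arbitrary: f g)
  case 0
  then show ?case by (simp add: continuous_on_add)
next
  case (Suc k)
  show ?case
    by (rule Ck_SucI[OF has_derivative_add[OF Ck_Suc_has_derivative[OF Suc.prems(1)]
          Ck_Suc_has_derivative[OF Suc.prems(2)]]]) (use Suc in auto)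
qed

lemma Ck_scaleR:
  fixes f :: "'a::euclidean_space \<Rightarrow> real"
  shows "Ck k f \<Longrightarrow> Ck k g \<Longrightarrow> Ck k (\<lambda>x. f x *\<^sub>R g x)"
proof (induction k arbitrary: f g)
  case 0
  then show ?case by (simp add: continuous_on_scaleR)
next
  case (Suc k)
  have "Ck k f" "Ck k g" "\<And>w. Ck k (\<lambda>x. frechet_derivative f (at x) w)"
    "\<And>w. Ck k (\<lambda>x. frechet_derivative g (at x) w)"
    using Suc.prems Ck_Suc_imp_Ck by auto
  then show ?case
    by (intro Ck_SucI[OF has_derivative_scaleR[OF Ck_Suc_has_derivative[OF Suc.prems(1)]
          Ck_Suc_has_derivative[OF Suc.prems(2)]]] Ck_add Suc.IH)
qed

lemma Ck_mult:
  fixes f g :: "'a::euclidean_space \<Rightarrow> real"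
  shows "Ck k f \<Longrightarrow> Ck k g \<Longrightarrow> Ck k (\<lambda>x. f x * g x)"
  using Ck_scaleR[of k f g] by simp

lemma Ck_prod:
  fixes f :: "'i \<Rightarrow> 'a::euclidean_space \<Rightarrow> real"
  shows "(\<And>i. i \<in> I \<Longrightarrow> Ck k (f i)) \<Longrightarrow> Ck k (\<lambda>x. \<Prod>i\<in>I. f i x)"
  by (induction I rule: infinite_finite_induct) (auto intro: Ck_mult Ck_const)

text \<open>The derivative of \<open>f \<circ> q\<close> in direction \<open>w\<close> is a product whose second factor is \<open>f'\<close> composed with \<open>q\<close>
again; the induction on the order closes because \<open>f\<close> is generalized.\<close>

lemma Ck_compose_real:
  fixes q :: "'a::euclidean_space \<Rightarrow> real" and f :: "real \<Rightarrow> 'b::real_normed_vector"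
  shows "Ck k f \<Longrightarrow> Ck k q \<Longrightarrow> Ck k (\<lambda>x. f (q x))"
proof (induction k arbitrary: f)
  case 0
  then show ?case by (auto intro: continuous_on_compose2)
next
  case (Suc k)
  show ?case
  proof (rule Ck_SucI)
    fix x
    have lin: "frechet_derivative f (at (q x)) s = s *\<^sub>R frechet_derivative f (at (q x)) 1" for s
      using linear_scale[OF bounded_linear.linear[OF has_derivative_bounded_linear
            [OF Ck_Suc_has_derivative[OF Suc.prems(1)]]], of "q x" s 1] by simp
    show "((\<lambda>x. f (q x)) has_derivative
        (\<lambda>w. frechet_derivative q (at x) w *\<^sub>R frechet_derivative f (at (q x)) 1)) (at x)"
      by (subst lin[symmetric]) (rule has_derivative_compose[OF
            Ck_Suc_has_derivative[OF Suc.prems(2)] Ck_Suc_has_derivative[OF Suc.prems(1)]])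
  next
    fix w
    show "Ck k (\<lambda>x. frechet_derivative q (at x) w *\<^sub>R frechet_derivative f (at (q x)) 1)"
      using Suc.prems Suc.IH[OF _ Ck_Suc_imp_Ck[OF Suc.prems(2)], of "\<lambda>s. frechet_derivative f (at s) 1"]
      by (intro Ck_scaleR) auto
  qed
qed

text \<open>The classical smooth function that is flat at the origin, divided by powers of its argument.  The
powers are included because the family indexed by \<open>j\<close> is closed under differentiation up to linear
combinations, so that smoothness of all its members is proved by one induction.\<close>

definition flat_exp :: "nat \<Rightarrow> real \<Rightarrow> real" where
  "flat_exp j t = (if t > 0 then exp (- 1 / t) / t ^ j else 0)"

lemma flat_exp_tendsto_0: "((\<lambda>t. exp (- 1 / t) / t ^ j) \<longlongrightarrow> 0) (at_right (0::real))"
proof -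
  have "((\<lambda>t::real. (inverse t) ^ j / exp (inverse t)) \<longlongrightarrow> 0) (at_right 0)"
    by (rule filterlim_compose[OF tendsto_power_div_exp_0 filterlim_inverse_at_top_right])
  then show ?thesis
    by (rule Lim_transform_eventually)
       (auto intro!: eventuallyI simp: exp_minus field_simps power_inverse)
qed

lemma flat_exp_has_real_derivative:
  "(flat_exp j has_real_derivative flat_exp (j + 2) t - j * flat_exp (j + 1) t) (at t)"
proof -
  consider "t > 0" | "t < 0" | "t = 0" by linarith
  then show ?thesis
  proof cases
    case 1
    have "((\<lambda>t. exp (- 1 / t) / t ^ j) has_real_derivative
        flat_exp (j + 2) t - j * flat_exp (j + 1) t) (at t)"
      using 1 by (auto intro!: derivative_eq_intros simp: flat_exp_def divide_simps power2_eq_square)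
        (cases j; auto simp: algebra_simps)
    then show ?thesis
      by (rule has_field_derivative_transform_within_open[where S = "{0<..}"])
        (use 1 in \<open>auto simp: flat_exp_def\<close>)
  next
    case 2
    have "((\<lambda>t. 0) has_real_derivative flat_exp (j + 2) t - j * flat_exp (j + 1) t) (at t)"
      using 2 by (simp add: flat_exp_def)
    then show ?thesis
      by (rule has_field_derivative_transform_within_open[where S = "{..<0}"])
        (use 2 in \<open>auto simp: flat_exp_def\<close>)
  next
    case 3
    have "((\<lambda>h. flat_exp j h / h) \<longlongrightarrow> 0) (at_right 0)"
      by (rule Lim_transform_eventually[OF flat_exp_tendsto_0[of "Suc j"]])
         (auto simp: eventually_at_filter flat_exp_def field_simps)
    moreover have "((\<lambda>h. flat_exp j h / h) \<longlongrightarrow> 0) (at_left 0)"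
      by (rule Lim_transform_eventually[OF tendsto_const])
         (auto simp: eventually_at_filter flat_exp_def)
    ultimately have "((\<lambda>h. flat_exp j h / h) \<longlongrightarrow> 0) (at 0)"
      by (simp add: filterlim_split_at)
    then show ?thesis
      using 3 by (simp add: has_field_derivative_iff flat_exp_def)
  qed
qed

lemma Ck_flat_exp: "Ck k (flat_exp j)"
proof (induction k arbitrary: j)
  case 0
  then show ?case
    using DERIV_isCont[OF flat_exp_has_real_derivative] continuous_at_imp_continuous_on
    by (simp, blast)
next
  case (Suc k)
  have *: "Ck k (\<lambda>x. flat_exp (j + 2) x + (- real j) * flat_exp (j + 1) x)"
    by (intro Ck_add Ck_mult Ck_const Suc)
  show ?case
  proof (rule Ck_SucI)
    show "(flat_exp j has_derivative (\<lambda>w. (flat_exp (j + 2) t - j * flat_exp (j + 1) t) * w)) (at t)" for t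
      using flat_exp_has_real_derivative by (simp add: has_field_derivative_def)
    show "Ck k (\<lambda>x. (flat_exp (j + 2) x - j * flat_exp (j + 1) x) * w)" for w
      using Ck_mult[OF * Ck_const[of k w]] by simp
  qed
qed

text \<open>The shift \<open>d\<close> keeps the base away from the singularity of the power at zero.  The exponent is
arbitrary for the same reason as above: differentiation only lowers it by one.\<close>

lemma has_derivative_inner_self_powr:
  fixes x :: "'a::euclidean_space"
  assumes "d > 0"
  shows "((\<lambda>x. (x \<bullet> x + d) powr a) has_derivative
    (\<lambda>w. (x \<bullet> x + d) powr (a - 1) * (2 * a * (x \<bullet> w)))) (at x)"
proof -
  have "x \<bullet> x + d > 0" using assms inner_ge_zero[of x] by linarith
  then show ?thesis
    by (auto intro!: derivative_eq_intros simp: inner_commute powr_diff)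
qed

lemma Ck_inner_self_powr:
  fixes d :: real
  assumes "d > 0"
  shows "Ck k (\<lambda>x::'a::euclidean_space. (x \<bullet> x + d) powr a)"
proof (induction k arbitrary: a)
  case 0
  have "x \<bullet> x + d \<noteq> 0" for x :: 'a
    using assms inner_ge_zero[of x] by linarith
  then show ?case by (auto intro!: continuous_intros)
next
  case (Suc k)
  show ?case
  proof (rule Ck_SucI[OF has_derivative_inner_self_powr[OF assms]])
    fix w :: 'a
    have "bounded_linear (\<lambda>x. 2 * a * (x \<bullet> w))"
      by (intro bounded_linear_const_mult bounded_linear_inner_left)
    then show "Ck k (\<lambda>x. (x \<bullet> x + d) powr (a - 1) * (2 * a * (x \<bullet> w)))"
      by (intro Ck_mult Suc Ck_bounded_linear[OF _ Ck_ident, simplified])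
  qed
qed

lemma Ck_inner_self:
  "Ck k (\<lambda>x::'a::euclidean_space. x \<bullet> x)"
proof (cases k)
  case (Suc k')
  show ?thesis unfolding Suc
  proof (rule Ck_SucI)
    show "((\<lambda>x. x \<bullet> x) has_derivative (\<lambda>w. 2 * (x \<bullet> w))) (at x)" for x :: 'a
      by (auto intro!: derivative_eq_intros simp: inner_commute)
    have "bounded_linear (\<lambda>x. 2 * (x \<bullet> w))" for w :: 'a
      by (intro bounded_linear_const_mult bounded_linear_inner_left)
    then show "Ck k' (\<lambda>x. 2 * (x \<bullet> w))" for w :: 'a
      by (rule Ck_bounded_linear[OF _ Ck_ident])
  qed
qed (auto intro!: continuous_intros)

section \<open>Test functions and integration by parts\<close>

lemma integrable_scaleR_bounded:
  fixes f :: "'a \<Rightarrow> real" and g :: "'a \<Rightarrow> 'b::euclidean_space"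
  assumes "integrable M f" "g \<in> borel_measurable M" "\<And>x. norm (g x) \<le> B"
  shows "integrable M (\<lambda>x. f x *\<^sub>R g x)"
proof (rule Bochner_Integration.integrable_bound)
  show "integrable M (\<lambda>x. B * f x)" using assms by simp
  show "(\<lambda>x. f x *\<^sub>R g x) \<in> borel_measurable M"
    using assms(2) borel_measurable_integrable[OF assms(1)] by simp
  have "norm (f x *\<^sub>R g x) \<le> norm (B * f x)" for x
    using mult_right_mono[OF assms(3)[of x], of "\<bar>f x\<bar>"] order_trans[OF norm_ge_zero assms(3)[of x]]
    by (simp add: abs_mult mult.commute)
  then show "AE x in M. norm (f x *\<^sub>R g x) \<le> norm (B * f x)" by simp
qed

lemma borel_measurable_lebesgue_continuous:
  fixes f :: "'a::euclidean_space \<Rightarrow> 'b::euclidean_space"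
  assumes "continuous_on UNIV f"
  shows "f \<in> borel_measurable lebesgue"
  using borel_measurable_continuous_onI[OF assms]
  by (simp add: measurable_completion)

lemma integrable_continuous_bounded_support:
  fixes f :: "'a::euclidean_space \<Rightarrow> 'b::euclidean_space"
  assumes f: "continuous_on UNIV f" and S: "bounded S" "\<And>x. x \<notin> S \<Longrightarrow> f x = 0"
  shows "integrable lborel f" "integrable lebesgue f"
proof -
  obtain R where R: "S \<subseteq> cball 0 R"
    using S(1) by (auto simp: bounded_iff subset_iff)
  have "integrable lborel (\<lambda>x. indicator (cball 0 R) x *\<^sub>R f x)"
    by (intro borel_integrable_compact) (auto intro: continuous_on_subset[OF f])
  also have "(\<lambda>x. indicator (cball 0 R) x *\<^sub>R f x) = f"
    using S(2) R by (intro ext) (metis indicator_simps scaleR_one scaleR_zero_left subsetD)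
  finally show "integrable lborel f" .
  then show "integrable lebesgue f"
    using borel_measurable_continuous_onI[OF f] by (simp add: integrable_completion)
qed

lemma bounded_continuous_bounded_support:
  fixes f :: "'a::euclidean_space \<Rightarrow> 'b::euclidean_space"
  assumes f: "continuous_on UNIV f" and S: "bounded S" "\<And>x. x \<notin> S \<Longrightarrow> f x = 0"
  obtains B where "B > 0" "\<And>x. norm (f x) \<le> B"
proof -
  obtain R where R: "S \<subseteq> cball 0 R"
    using S(1) by (auto simp: bounded_iff subset_iff)
  have "bounded (f ` cball 0 R)"
    by (intro compact_imp_bounded compact_continuous_image continuous_on_subset[OF f]) auto
  then obtain B where B: "B > 0" "\<And>x. x \<in> cball 0 R \<Longrightarrow> norm (f x) \<le> B"
    by (auto simp: bounded_pos)
  have "norm (f x) \<le> B" for x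
    using B S(2)[of x] R by (cases "x \<in> S") auto
  with B(1) that show thesis by blast
qed

lemma has_derivative_zero_outside_support:
  fixes g :: "'a::euclidean_space \<Rightarrow> 'b::real_normed_vector"
  assumes "(g has_derivative g') (at x)" "x \<notin> closure {x. g x \<noteq> 0}"
  shows "g' = (\<lambda>w. 0)"
proof -
  have "((\<lambda>x. 0) has_derivative g') (at x)"
    by (rule has_derivative_transform_within_open[OF assms(1), of "- closure {x. g x \<noteq> 0}"])
       (use assms(2) closure_subset[of "{x. g x \<noteq> 0}"] in auto)
  then show ?thesis
    using has_derivative_unique[OF _ has_derivative_const] by blast
qed

text \<open>By translation invariance of Lebesgue measure the difference quotients of \<open>g\<close> in the direction \<open>b\<close>
have integral zero.  They converge to the derivative, and the mean value theorem bounds them by its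
maximum on a fixed ball.\<close>

lemma integral_directional_derivative_eq_0:
  fixes g :: "'a::euclidean_space \<Rightarrow> real"
  assumes der: "\<And>x. (g has_derivative g' x) (at x)"
    and cont: "continuous_on UNIV (\<lambda>x. g' x b)"
    and bdd: "bounded {x. g x \<noteq> 0}"
  shows "(LINT x|lebesgue. g' x b) = 0"
proof -
  define S where "S = closure {x. g x \<noteq> 0}"
  have S: "bounded S" using bounded_closure[OF bdd] by (simp add: S_def)
  have g0: "g x = 0" if "x \<notin> S" for x
    using that closure_subset[of "{x. g x \<noteq> 0}"] by (auto simp: S_def)
  have g'0: "g' x b = 0" if "x \<notin> S" for x
    using has_derivative_zero_outside_support[OF der] that by (simp add: S_def)
  obtain B where B: "B > 0" "\<And>x. norm (g' x b) \<le> B"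
    using bounded_continuous_bounded_support[OF cont S] g'0 by blast
  obtain R where R: "S \<subseteq> cball 0 R"
    using S by (auto simp: bounded_iff subset_iff)
  have cg: "continuous_on UNIV g"
    using der by (intro continuous_at_imp_continuous_on ballI has_derivative_continuous) blast
  have [measurable]: "g \<in> borel_measurable borel"
    using cg by (rule borel_measurable_continuous_onI)
  have ig: "integrable lborel g"
    using integrable_continuous_bounded_support[OF cg S] g0 by blast
  \<comment> \<open>difference quotients with step \<open>1 / (k + 1)\<close>\<close>
  define s where "s = (\<lambda>k x. (g (x + (1 / real (Suc k)) *\<^sub>R b) - g x) * real (Suc k))"
  have s_bound: "\<bar>s k x\<bar> \<le> B" for k x
  proof -
    define t where "t = 1 / real (Suc k)"
    have t: "t > 0" by (simp add: t_def)
    have "((\<lambda>r. g (x + r *\<^sub>R b)) has_real_derivative g' (x + r *\<^sub>R b) b) (at r)" for r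
    proof -
      have "((\<lambda>r. x + r *\<^sub>R b) has_derivative (\<lambda>r. r *\<^sub>R b)) (at r)"
        by (auto intro!: derivative_eq_intros)
      from has_derivative_compose[OF this der]
      have "((\<lambda>r. g (x + r *\<^sub>R b)) has_derivative (\<lambda>h. g' (x + r *\<^sub>R b) (h *\<^sub>R b))) (at r)" .
      moreover have "g' (x + r *\<^sub>R b) (h *\<^sub>R b) = g' (x + r *\<^sub>R b) b * h" for h
        using linear_scale[OF bounded_linear.linear[OF has_derivative_bounded_linear[OF der]]]
        by simp
      ultimately show ?thesis by (simp add: has_field_derivative_def)
    qed
    from MVT2[OF t this] obtain z where "g (x + t *\<^sub>R b) - g (x + 0 *\<^sub>R b) = (t - 0) * g' (x + z *\<^sub>R b) b"
      by blast
    then have "s k x = g' (x + z *\<^sub>R b) b"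
      using t by (simp add: s_def t_def field_simps)
    then show ?thesis using B(2)[of "x + z *\<^sub>R b"] by simp
  qed
  have s0: "s k x = 0" if "x \<notin> cball 0 (R + norm b)" for k x
  proof -
    have *: "norm ((1 / real (Suc k)) *\<^sub>R b) \<le> norm b"
      by (simp add: field_simps)
    have "norm x \<le> norm (x + (1 / real (Suc k)) *\<^sub>R b) + norm ((1 / real (Suc k)) *\<^sub>R b)"
      using norm_triangle_ineq4[of "x + (1 / real (Suc k)) *\<^sub>R b" "(1 / real (Suc k)) *\<^sub>R b"] by simp
    then have "x \<notin> S" "x + (1 / real (Suc k)) *\<^sub>R b \<notin> S"
      using that * R norm_ge_zero[of b] by (auto simp: subset_iff) (smt (verit) norm_ge_zero)+
    then show ?thesis using g0 by (simp add: s_def)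
  qed
  have "(\<lambda>k. \<integral>x. s k x \<partial>lborel) \<longlonglongrightarrow> (\<integral>x. g' x b \<partial>lborel)"
  proof (rule integral_dominated_convergence)
    show "(\<lambda>x. g' x b) \<in> borel_measurable lborel"
      using borel_measurable_continuous_onI[OF cont] by simp
    show "integrable lborel (\<lambda>x. indicator (cball 0 (R + norm b)) x *\<^sub>R B)"
      by (intro borel_integrable_compact) auto
    show "AE x in lborel. norm (s k x) \<le> indicator (cball 0 (R + norm b)) x *\<^sub>R B" for k
      using s_bound[of k] s0[of _ k] by (intro AE_I2) (auto simp: indicator_def)
    show "AE x in lborel. (\<lambda>k. s k x) \<longlonglongrightarrow> g' x b"
    proof (intro AE_I2)
      fix x
      have "((\<lambda>r. x + r *\<^sub>R b) has_derivative (\<lambda>r. r *\<^sub>R b)) (at 0)"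
        by (auto intro!: derivative_eq_intros)
      from has_derivative_compose[OF this, of g "g' x"] der[of x]
      have "((\<lambda>r. g (x + r *\<^sub>R b)) has_derivative (\<lambda>h. g' x (h *\<^sub>R b))) (at 0)" by simp
      moreover have "g' x (h *\<^sub>R b) = g' x b * h" for h
        using linear_scale[OF bounded_linear.linear[OF has_derivative_bounded_linear[OF der]]]
        by simp
      ultimately have "((\<lambda>r. g (x + r *\<^sub>R b)) has_real_derivative g' x b) (at 0)"
        by (simp add: has_field_derivative_def)
      then have lim: "((\<lambda>r. (g (x + r *\<^sub>R b) - g x) / r) \<longlongrightarrow> g' x b) (at 0)"
        by (simp add: has_field_derivative_iff)
      have "filterlim (\<lambda>k. 1 / real (Suc k)) (at 0) sequentially"
        unfolding filterlim_at using LIMSEQ_inverse_real_of_nat by (simp add: inverse_eq_divide)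
      from filterlim_compose[OF lim this]
      show "(\<lambda>k. s k x) \<longlonglongrightarrow> g' x b" by (simp add: s_def)
    qed
  qed (simp add: s_def)
  moreover have "(\<integral>x. s k x \<partial>lborel) = 0" for k
  proof -
    have *: "has_bochner_integral lborel (\<lambda>x. g (c + x)) (\<integral>x. g x \<partial>lborel)" for c
    proof -
      have "integral\<^sup>L (distr lborel borel ((+) c)) g = (\<integral>x. g (c + x) \<partial>lborel)"
        by (subst integral_distr) auto
      moreover have "integrable (distr lborel borel ((+) c)) g = integrable lborel (\<lambda>x. g (c + x))"
        by (subst integrable_distr_eq) auto
      ultimately show ?thesis using ig by (simp add: lborel_distr_plus has_bochner_integral_iff)
    qed
    show ?thesis unfolding s_def
      using *[of "(1 / real (Suc k)) *\<^sub>R b"] ig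
      by (simp add: has_bochner_integral_iff add.commute)
  qed
  ultimately have "(\<integral>x. g' x b \<partial>lborel) = 0"
    using LIMSEQ_unique[OF _ tendsto_const] by simp
  then show ?thesis
    using borel_measurable_continuous_onI[OF cont] by (simp add: integral_completion)
qed

lemma test_functions_has_derivative:
  "\<phi> \<in> test_functions U \<Longrightarrow> (\<phi> has_derivative frechet_derivative \<phi> (at x)) (at x)"
  unfolding test_functions_def using Ck_Suc_has_derivative by blast

lemma test_functions_continuous: "\<phi> \<in> test_functions U \<Longrightarrow> continuous_on UNIV \<phi>"
  unfolding test_functions_def using Ck_imp_continuous_on by blast

lemma test_functions_derivative_continuous:
  "\<phi> \<in> test_functions U \<Longrightarrow> continuous_on UNIV (\<lambda>x. frechet_derivative \<phi> (at x) w)"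
  unfolding test_functions_def using Ck.simps(2)[of 0 \<phi>] by (metis (mono_tags) Ck.simps(1) mem_Collect_eq)

lemma test_functions_bounded_support:
  "\<phi> \<in> test_functions U \<Longrightarrow> bounded (closure {x. \<phi> x \<noteq> 0})"
  unfolding test_functions_def by (auto intro: compact_imp_bounded)

lemma test_functions_support:
  assumes "\<phi> \<in> test_functions U" "x \<notin> U"
  shows "\<phi> x = 0" "frechet_derivative \<phi> (at x) w = 0"
proof -
  have "x \<notin> closure {x. \<phi> x \<noteq> 0}" using assms by (auto simp: test_functions_def)
  then show "\<phi> x = 0" "frechet_derivative \<phi> (at x) w = 0"
    using has_derivative_zero_outside_support[OF test_functions_has_derivative[OF assms(1)]]
      closure_subset[of "{x. \<phi> x \<noteq> 0}"] by auto
qed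

lemma test_functions_bounded:
  fixes \<phi> :: "'a::euclidean_space \<Rightarrow> 'b::euclidean_space"
  assumes "\<phi> \<in> test_functions U"
  obtains B where "B > 0" "\<And>x. norm (\<phi> x) \<le> B"
  using bounded_continuous_bounded_support[OF test_functions_continuous[OF assms]
      test_functions_bounded_support[OF assms]] closure_subset[of "{x. \<phi> x \<noteq> 0}"] by blast

lemma test_functions_derivative_bounded:
  fixes \<phi> :: "'a::euclidean_space \<Rightarrow> 'b::euclidean_space"
  assumes "\<phi> \<in> test_functions U"
  obtains B where "B > 0" "\<And>x. norm (frechet_derivative \<phi> (at x) w) \<le> B"
proof (rule bounded_continuous_bounded_support[OF test_functions_derivative_continuous[OF assms]
      test_functions_bounded_support[OF assms]])
  show "frechet_derivative \<phi> (at x) w = 0" if "x \<notin> closure {x. \<phi> x \<noteq> 0}" for x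
    using has_derivative_zero_outside_support[OF test_functions_has_derivative[OF assms] that] by simp
qed (use that in blast)

lemma test_functionsI:
  assumes "\<And>k. Ck k \<phi>" "{x. \<phi> x \<noteq> 0} \<subseteq> K" "compact K" "K \<subseteq> U"
  shows "\<phi> \<in> test_functions U"
proof -
  have "closure {x. \<phi> x \<noteq> 0} \<subseteq> K"
    using assms(2,3) by (simp add: closure_minimal compact_imp_closed)
  moreover from this have "compact (closure {x. \<phi> x \<noteq> 0})"
    using assms(3) by (meson closed_closure compact_closure bounded_subset compact_imp_bounded closure_subset)
  ultimately show ?thesis
    using assms by (auto simp: test_functions_def)
qed

text \<open>The product of \<open>u\<close> with a test function is differentiable with compact support, so the integral of
its derivative vanishes; the product rule turns this into the integration by parts formula.\<close>

lemma is_L1_weak_gradient_C1: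
  fixes u :: "'a::euclidean_space \<Rightarrow> real"
  assumes der: "\<And>x. (u has_derivative (\<lambda>w. g x \<bullet> w)) (at x)"
    and cont: "continuous_on UNIV g" and int: "g absolutely_integrable_on U"
  shows "is_L1_weak_gradient U u g"
  unfolding is_L1_weak_gradient_def
proof (intro conjI int ballI)
  fix \<phi> :: "'a \<Rightarrow> real" and b :: 'a
  assume \<phi>: "\<phi> \<in> test_functions U"
  let ?D = "\<lambda>x. frechet_derivative \<phi> (at x) b"
  define S where "S = closure {x. \<phi> x \<noteq> 0}"
  have supp: "bounded S" using test_functions_bounded_support[OF \<phi>] by (simp add: S_def)
  have out: "\<phi> x = 0" "?D x = 0" if "x \<notin> S" for x
    using has_derivative_zero_outside_support[OF test_functions_has_derivative[OF \<phi>]]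
      that closure_subset[of "{x. \<phi> x \<noteq> 0}"] unfolding S_def by auto
  have cu: "continuous_on UNIV u"
    using der by (intro continuous_at_imp_continuous_on ballI has_derivative_continuous) blast
  have c1: "continuous_on UNIV (\<lambda>x. u x * ?D x)"
    by (intro continuous_intros cu test_functions_derivative_continuous[OF \<phi>])
  have c2: "continuous_on UNIV (\<lambda>x. (g x \<bullet> b) * \<phi> x)"
    by (intro continuous_intros cont test_functions_continuous[OF \<phi>])
  have i1: "integrable lebesgue (\<lambda>x. u x * ?D x)"
    by (rule integrable_continuous_bounded_support(2)[OF c1 supp]) (use out in auto)
  have i2: "integrable lebesgue (\<lambda>x. (g x \<bullet> b) * \<phi> x)"
    by (rule integrable_continuous_bounded_support(2)[OF c2 supp]) (use out in auto)
  have "(LINT x|lebesgue. u x * frechet_derivative \<phi> (at x) b + (g x \<bullet> b) * \<phi> x) = 0"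
  proof (rule integral_directional_derivative_eq_0[where g = "\<lambda>x. u x * \<phi> x"
        and g' = "\<lambda>x w. u x * frechet_derivative \<phi> (at x) w + (g x \<bullet> w) * \<phi> x"])
    show "((\<lambda>x. u x * \<phi> x) has_derivative
        (\<lambda>w. u x * frechet_derivative \<phi> (at x) w + (g x \<bullet> w) * \<phi> x)) (at x)" for x
      by (rule has_derivative_mult[OF der test_functions_has_derivative[OF \<phi>]])
    show "continuous_on UNIV (\<lambda>x. u x * ?D x + (g x \<bullet> b) * \<phi> x)"
      by (intro continuous_on_add c1 c2)
    show "bounded {x. u x * \<phi> x \<noteq> 0}"
      by (rule bounded_subset[OF supp]) (use out in auto)
  qed
  then have eq: "(LINT x|lebesgue. u x * ?D x) = - (LINT x|lebesgue. (g x \<bullet> b) * \<phi> x)"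
    using i1 i2 by simp
  have "(LINT x:U|lebesgue. u x * ?D x) = (LINT x|lebesgue. u x * ?D x)"
    "(LINT x:U|lebesgue. (g x \<bullet> b) * \<phi> x) = (LINT x|lebesgue. (g x \<bullet> b) * \<phi> x)"
    unfolding set_lebesgue_integral_def
    by (rule Bochner_Integration.integral_cong[OF refl],
        use test_functions_support[OF \<phi>] in \<open>auto simp: indicator_def\<close>)+
  with eq show "(LINT x:U|lebesgue. u x * frechet_derivative \<phi> (at x) b) =
        - (LINT x:U|lebesgue. (g x \<bullet> b) * \<phi> x)" by simp
qed

lemma test_functions_inner:
  assumes v: "v \<in> test_functions U"
  shows "(\<lambda>x. v x \<bullet> b) \<in> test_functions U"
    and "frechet_derivative (\<lambda>x. v x \<bullet> b) (at x) w = frechet_derivative v (at x) w \<bullet> b"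
proof -
  show "(\<lambda>x. v x \<bullet> b) \<in> test_functions U"
  proof (rule test_functionsI)
    show "Ck k (\<lambda>x. v x \<bullet> b)" for k
      by (rule Ck_bounded_linear[OF bounded_linear_inner_left])
         (use v in \<open>simp add: test_functions_def\<close>)
    show "{x. v x \<bullet> b \<noteq> 0} \<subseteq> closure {x. v x \<noteq> 0}"
      using closure_subset[of "{x. v x \<noteq> 0}"] by auto
  qed (use v in \<open>auto simp: test_functions_def\<close>)
  have "((\<lambda>x. v x \<bullet> b) has_derivative (\<lambda>w. frechet_derivative v (at x) w \<bullet> b)) (at x)"
    using has_derivative_inner_left[OF test_functions_has_derivative[OF v]] .
  then show "frechet_derivative (\<lambda>x. v x \<bullet> b) (at x) w = frechet_derivative v (at x) w \<bullet> b"
    using frechet_derivative_at by metis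
qed

text \<open>Testing the weak gradient against the components of a field \<open>v\<close> turns \<open>\<integral>u div v\<close> into \<open>-\<integral>g\<bullet>v\<close>, which
the Cauchy--Schwarz inequality bounds.  This is the inclusion of the Sobolev space in \<open>BV\<close>, and it
is also how the variation of explicit functions is estimated.\<close>

lemma total_variation_le_weak_gradient:
  fixes u :: "'a::euclidean_space \<Rightarrow> real"
  assumes u: "u absolutely_integrable_on U" and g: "is_L1_weak_gradient U u g"
  shows "total_variation U u \<le> ereal (L1_norm U g)"
  unfolding total_variation_def
proof (intro SUP_least)
  fix v :: "'a \<Rightarrow> 'a" assume "v \<in> {v \<in> test_functions U. \<forall>x. norm (v x) \<le> 1}"
  then have v: "v \<in> test_functions U" and v1: "\<And>x. norm (v x) \<le> 1" by auto
  have iu: "integrable lebesgue (\<lambda>x. indicator U x * u x)"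
    using u by (simp add: set_integrable_def)
  have ig: "integrable lebesgue (\<lambda>x. indicator U x *\<^sub>R g x)"
    using g by (simp add: is_L1_weak_gradient_def set_integrable_def)
  have igb: "integrable lebesgue (\<lambda>x. indicator U x * (g x \<bullet> b))" for b
    using integrable_inner_left[OF ig, of b] by simp
  have i1: "integrable lebesgue (\<lambda>x. indicator U x * u x * (frechet_derivative v (at x) b \<bullet> b))" for b
  proof -
    obtain B where "\<And>x. norm (frechet_derivative (\<lambda>x. v x \<bullet> b) (at x) b) \<le> B"
      using test_functions_derivative_bounded[OF test_functions_inner(1)[OF v]] by blast
    with integrable_scaleR_bounded[OF iu, of "\<lambda>x. frechet_derivative v (at x) b \<bullet> b" B]
    show ?thesis
      using borel_measurable_lebesgue_continuous[OF
          test_functions_derivative_continuous[OF test_functions_inner(1)[OF v]]]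
      by (simp add: test_functions_inner(2)[OF v])
  qed
  have i2: "integrable lebesgue (\<lambda>x. indicator U x * (g x \<bullet> b) * (v x \<bullet> b))" if "b \<in> Basis" for b
    using integrable_scaleR_bounded[OF igb, of "\<lambda>x. v x \<bullet> b" 1]
      borel_measurable_lebesgue_continuous[OF test_functions_continuous[OF test_functions_inner(1)[OF v]]]
      Basis_le_norm[OF that] v1
    by (simp add: order_trans[OF Basis_le_norm[OF that] v1])
  have "(LINT x:U|lebesgue. u x * divergence v x) =
      (LINT x|lebesgue. (\<Sum>b\<in>Basis. indicator U x * u x * (frechet_derivative v (at x) b \<bullet> b)))"
    by (simp add: set_lebesgue_integral_def divergence_def sum_distrib_left mult.assoc)
  also have "\<dots> = (\<Sum>b\<in>Basis. LINT x|lebesgue. indicator U x * u x * (frechet_derivative v (at x) b \<bullet> b))"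
    by (intro Bochner_Integration.integral_sum i1)
  also have "\<dots> = (\<Sum>b\<in>Basis. - (LINT x|lebesgue. indicator U x * (g x \<bullet> b) * (v x \<bullet> b)))"
  proof (rule sum.cong[OF refl])
    fix b :: 'a assume "b \<in> Basis"
    then have "(LINT x:U|lebesgue. u x * frechet_derivative (\<lambda>x. v x \<bullet> b) (at x) b) =
        - (LINT x:U|lebesgue. (g x \<bullet> b) * (v x \<bullet> b))"
      using g test_functions_inner(1)[OF v] by (auto simp: is_L1_weak_gradient_def)
    then show "(LINT x|lebesgue. indicator U x * u x * (frechet_derivative v (at x) b \<bullet> b)) =
        - (LINT x|lebesgue. indicator U x * (g x \<bullet> b) * (v x \<bullet> b))"
      by (simp add: test_functions_inner(2)[OF v] set_lebesgue_integral_def mult.assoc)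
  qed
  also have "\<dots> = - (LINT x|lebesgue. (\<Sum>b\<in>Basis. indicator U x * (g x \<bullet> b) * (v x \<bullet> b)))"
    by (simp add: sum_negf i2)
  also have "\<dots> = (LINT x|lebesgue. - (\<Sum>b\<in>Basis. indicator U x * (g x \<bullet> b) * (v x \<bullet> b)))"
    by simp
  also have "\<dots> \<le> (LINT x|lebesgue. indicator U x * norm (g x))"
  proof (rule integral_mono)
    show "integrable lebesgue (\<lambda>x. - (\<Sum>b\<in>Basis. indicator U x * (g x \<bullet> b) * (v x \<bullet> b)))"
      by (intro integrable_minus Bochner_Integration.integrable_sum i2)
    show "integrable lebesgue (\<lambda>x. indicator U x * norm (g x))"
      using integrable_norm[OF ig] by simp
    show "- (\<Sum>b\<in>Basis. indicator U x * (g x \<bullet> b) * (v x \<bullet> b)) \<le> indicator U x * norm (g x)" for x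
    proof -
      have "- (\<Sum>b\<in>Basis. indicator U x * (g x \<bullet> b) * (v x \<bullet> b)) = indicator U x * - (g x \<bullet> v x)"
        by (simp add: euclidean_inner[of "g x" "v x"] sum_distrib_left mult.assoc)
      also have "- (g x \<bullet> v x) \<le> norm (g x) * norm (v x)"
        using norm_cauchy_schwarz[of "- g x" "v x"] by simp
      then have "indicator U x * - (g x \<bullet> v x) \<le> indicator U x * norm (g x)"
        using mult_left_mono[OF v1[of x], of "norm (g x)"]
        by (intro mult_left_mono) (auto)
      finally show ?thesis .
    qed
  qed
  also have "\<dots> = L1_norm U g" by (simp add: L1_norm_def set_lebesgue_integral_def)
  finally show "ereal (LINT x:U|lebesgue. u x * divergence v x) \<le> ereal (L1_norm U g)" by simp
qed

section \<open>Uniqueness of weak gradients\<close>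

text \<open>Products over the coordinates of \<open>exp (- 1 / (n * \<tau>))\<close>, where \<open>\<tau>\<close> is the distance to a face of the
box: each factor is smooth across the face and tends to \<open>1\<close> in the interior.\<close>

lemma smooth_box_approximation:
  fixes a b :: "'a::euclidean_space"
  obtains \<phi> :: "nat \<Rightarrow> 'a \<Rightarrow> real"
  where "\<And>n U. cbox a b \<subseteq> U \<Longrightarrow> \<phi> n \<in> test_functions U"
    and "\<And>n x. 0 \<le> \<phi> n x" "\<And>n x. \<phi> n x \<le> 1"
    and "\<And>x. (\<lambda>n. \<phi> n x) \<longlonglongrightarrow> indicator (box a b) x"
proof -
  define \<phi> :: "nat \<Rightarrow> 'a \<Rightarrow> real" where "\<phi> = (\<lambda>n x. \<Prod>i\<in>Basis.
    flat_exp 0 (real (Suc n) * ((x - a) \<bullet> i)) * flat_exp 0 (real (Suc n) * ((b - x) \<bullet> i)))"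
  have fe: "0 \<le> flat_exp 0 t" "flat_exp 0 t \<le> 1" for t
    by (auto simp: flat_exp_def)
  have zero: "\<phi> n x = 0" if out: "x \<notin> box a b" for n x
  proof -
    obtain i where "i \<in> Basis" "x \<bullet> i \<le> a \<bullet> i \<or> b \<bullet> i \<le> x \<bullet> i"
      using out unfolding mem_box by (meson not_less)
    then show ?thesis unfolding \<phi>_def
      by (intro prod_zero) (auto simp: flat_exp_def inner_diff_left zero_less_mult_iff intro!: bexI[of _ i])
  qed
  show thesis
  proof (rule that[of \<phi>])
    fix n and U :: "'a set" assume U: "cbox a b \<subseteq> U"
    show "\<phi> n \<in> test_functions U"
    proof (rule test_functionsI[of _ "cbox a b"])
      have "Ck k (\<lambda>x. flat_exp 0 (c * ((x - d) \<bullet> i)))" for k c i and d :: 'a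
      proof (rule Ck_compose_real[OF Ck_flat_exp])
        have "Ck k (\<lambda>x. (c *\<^sub>R (x + (- d))) \<bullet> i)"
          by (rule Ck_bounded_linear[OF bounded_linear_inner_left]
              Ck_bounded_linear[OF bounded_linear_scaleR_right] Ck_add Ck_ident Ck_const)+
        then show "Ck k (\<lambda>x. c * ((x - d) \<bullet> i))" by simp
      qed
      from this[of _ "real (Suc n)" a] this[of _ "- real (Suc n)" b]
      show "Ck k (\<phi> n)" for k
        unfolding \<phi>_def by (intro Ck_prod Ck_mult) (simp_all add: inner_diff_left algebra_simps)
      show "{x. \<phi> n x \<noteq> 0} \<subseteq> cbox a b"
        using zero box_subset_cbox by blast
    qed (use U in auto)
  next
    show "0 \<le> \<phi> n x" for n x unfolding \<phi>_def by (intro prod_nonneg ballI mult_nonneg_nonneg fe)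
    show "\<phi> n x \<le> 1" for n x unfolding \<phi>_def
      by (intro prod_le_1 conjI mult_nonneg_nonneg fe mult_le_one)
    show "(\<lambda>n. \<phi> n x) \<longlonglongrightarrow> indicator (box a b) x" for x
    proof (cases "x \<in> box a b")
      case True
      have *: "(\<lambda>n. flat_exp 0 (real (Suc n) * t)) \<longlonglongrightarrow> 1" if "t > 0" for t
      proof -
        have "(\<lambda>n. exp (- (inverse (real (Suc n)) / t))) \<longlonglongrightarrow> exp (- (0 / t))"
          by (intro tendsto_intros LIMSEQ_inverse_real_of_nat) (use that in auto)
        moreover have "flat_exp 0 (real (Suc n) * t) = exp (- (inverse (real (Suc n)) / t))" for n
          using that by (simp add: flat_exp_def divide_simps zero_less_mult_iff)
        ultimately show ?thesis by simp
      qed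
      have "(\<lambda>n. \<phi> n x) \<longlonglongrightarrow> (\<Prod>i\<in>(Basis::'a set). 1 * 1)"
        unfolding \<phi>_def using True
        by (intro tendsto_prod tendsto_mult *) (auto simp: mem_box inner_diff_left)
      then show ?thesis using True by simp
    qed (simp add: zero)
  qed
qed

text \<open>The approximation of boxes by test functions shows that \<open>h\<close> has integral zero over every open box
whose closure lies in \<open>U\<close>.  Boxes form an intersection-stable generator of the Borel sets, so inside
such a box the integral vanishes over all Borel sets, and \<open>h\<close> is zero almost everywhere there.
Countably many of these boxes exhaust \<open>U\<close> up to a null set.\<close>

lemma fundamental_lemma_of_calculus_of_variations:
  fixes h :: "'a::euclidean_space \<Rightarrow> real"
  assumes U: "open U" and h: "set_integrable lebesgue U h"
    and test: "\<And>\<phi>. \<phi> \<in> test_functions U \<Longrightarrow> (LINT x:U|lebesgue. h x * \<phi> x) = 0"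
  shows "AE x in lebesgue. x \<in> U \<longrightarrow> h x = 0"
proof -
  define h0 where "h0 = (\<lambda>x. indicator U x * h x)"
  have h0: "integrable lebesgue h0" using h by (simp add: h0_def set_integrable_def)
  have box0: "(LINT x|lebesgue. indicator (box a b) x * h0 x) = 0" if ab: "cbox a b \<subseteq> U" for a b
  proof -
    obtain \<phi> :: "nat \<Rightarrow> 'a \<Rightarrow> real" where \<phi>: "\<And>n U. cbox a b \<subseteq> U \<Longrightarrow> \<phi> n \<in> test_functions U"
      "\<And>n x. 0 \<le> \<phi> n x" "\<And>n x. \<phi> n x \<le> 1"
      "\<And>x. (\<lambda>n. \<phi> n x) \<longlonglongrightarrow> indicator (box a b) x"
      using smooth_box_approximation[of a b] by metis
    have "(\<lambda>n. LINT x|lebesgue. \<phi> n x * h0 x) \<longlonglongrightarrow> (LINT x|lebesgue. indicator (box a b) x * h0 x)"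
    proof (rule integral_dominated_convergence)
      show "integrable lebesgue (\<lambda>x. norm (h0 x))" using h0 by simp
      show "(\<lambda>x. \<phi> n x * h0 x) \<in> borel_measurable lebesgue" for n
        using borel_measurable_lebesgue_continuous[OF test_functions_continuous[OF \<phi>(1)[OF ab]]] h0
        by simp
      show "AE x in lebesgue. norm (\<phi> n x * h0 x) \<le> norm (h0 x)" for n
        using \<phi>(2,3) by (auto simp: abs_mult mult_left_le_one_le)
      show "AE x in lebesgue. (\<lambda>n. \<phi> n x * h0 x) \<longlonglongrightarrow> indicator (box a b) x * h0 x"
        using \<phi>(4) by (auto intro!: tendsto_mult_right)
      show "(\<lambda>x. indicat_real (box a b) x * h0 x) \<in> borel_measurable lebesgue"
        using h0 by (intro borel_measurable_times borel_measurable_indicator) auto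
    qed
    moreover have "(LINT x|lebesgue. \<phi> n x * h0 x) = 0" for n
      using test[OF \<phi>(1)[OF ab], of n]
      by (simp add: set_lebesgue_integral_def h0_def mult_ac)
    ultimately show ?thesis using LIMSEQ_unique[OF _ tendsto_const] by simp
  qed
  \<comment> \<open>the generator argument takes place in the Borel algebra, hence a Borel representative\<close>
  obtain h1 where h1 [measurable]: "h1 \<in> borel_measurable lborel" and h1_eq: "AE x in lborel. h0 x = h1 x"
    using completion_ex_borel_measurable_real borel_measurable_integrable[OF h0] by blast
  have h1_eq': "AE x in lebesgue. h0 x = h1 x" using h1_eq by (rule AE_completion)
  have h1_int: "integrable lborel h1"
  proof -
    have "integrable lebesgue h1"
      by (rule integrable_cong_AE[THEN iffD1, OF borel_measurable_integrable[OF h0]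
            measurable_completion[OF h1] h1_eq' h0])
    then show ?thesis using h1 by (simp add: integrable_completion)
  qed
  have box1: "(LINT x:box a b|lborel. h1 x) = 0" if "cbox a b \<subseteq> U" for a b
  proof -
    have "(LINT x:box a b|lborel. h1 x) = (LINT x|lebesgue. indicator (box a b) x * h1 x)"
      unfolding set_lebesgue_integral_def by (subst integral_completion) auto
    also have "\<dots> = (LINT x|lebesgue. indicator (box a b) x * h0 x)"
    proof (rule integral_cong_AE)
      show "(\<lambda>x. indicat_real (box a b) x * h1 x) \<in> borel_measurable lebesgue"
        by (rule measurable_completion) simp
      show "(\<lambda>x. indicat_real (box a b) x * h0 x) \<in> borel_measurable lebesgue"
        using h0 by (intro borel_measurable_times borel_measurable_indicator) auto
      show "AE x in lebesgue. indicat_real (box a b) x * h1 x = indicat_real (box a b) x * h0 x"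
        using h1_eq' by eventually_elim simp
    qed
    finally show ?thesis using box0[OF that] by simp
  qed
  have cell: "AE x in lborel. x \<in> box c d \<longrightarrow> h1 x = 0" if cd: "cbox c d \<subseteq> U" for c d
  proof -
    define F where "F = (\<lambda>x. indicator (box c d) x * h1 x)"
    have F: "integrable lborel F"
      unfolding F_def using integrable_mult_indicator[OF _ h1_int, of "box c d"] by simp
    have F_set: "set_integrable lborel A F" if "A \<in> sets borel" for A
      unfolding set_integrable_def using integrable_mult_indicator[OF _ F, of A] that by simp
    have F_UNIV: "(LINT x|lborel. F x) = 0"
      using box1[OF cd] by (simp add: F_def set_lebesgue_integral_def)
    have "(LINT x:A|lborel. F x) = 0" if "A \<in> sets borel" for A
    proof -
      let ?G = "range (\<lambda>(a, b). box a b :: 'a set)"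
      have "Int_stable ?G"
        by (auto simp: Int_stable_def box_Int_box)
      moreover have "?G \<subseteq> Pow UNIV" by auto
      moreover have sets: "sets borel = sigma_sets UNIV ?G"
        unfolding borel_eq_box by simp
      with that have "A \<in> sigma_sets UNIV ?G" by simp
      ultimately show ?thesis
      proof (induction rule: sigma_sets_induct_disjoint)
        case (basic A)
        then obtain a b where A: "A = box a b" by auto
        define a' b' where "a' = (\<Sum>i\<in>Basis. max (a\<bullet>i) (c\<bullet>i) *\<^sub>R i)"
          and "b' = (\<Sum>i\<in>Basis. min (b\<bullet>i) (d\<bullet>i) *\<^sub>R i)"
        have "box a b \<inter> box c d = box a' b'" by (simp add: box_Int_box a'_def b'_def)
        moreover have "cbox a' b' \<subseteq> cbox c d" by (auto simp: mem_box a'_def b'_def)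
        moreover have "(LINT x:A|lborel. F x) = (LINT x:box a b \<inter> box c d|lborel. h1 x)"
          by (simp add: set_lebesgue_integral_def F_def A indicator_inter_arith mult.assoc)
        ultimately show ?case using box1[of a' b'] cd by auto
      next
        case empty
        then show ?case by (simp add: set_lebesgue_integral_def)
      next
        case (compl A)
        then have A: "A \<in> sets borel" using sets by simp
        have "(LINT x:UNIV - A|lborel. F x) = (LINT x|lborel. F x - indicator A x * F x)"
          unfolding set_lebesgue_integral_def
          by (rule Bochner_Integration.integral_cong) (auto simp: indicator_def)
        also have "\<dots> = 0"
          using F F_set[OF A] compl F_UNIV
          by (simp add: set_integrable_def set_lebesgue_integral_def)
        finally show ?case .
      next
        case (union A)
        then have A: "A i \<in> sets borel" for i using sets by auto
        have "(LINT x:(\<Union>i. A i)|lborel. F x) = (\<Sum>i. (LINT x:(A i)|lborel. F x))"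
          using A union(1) by (intro lebesgue_integral_countable_add F_set) (auto simp: disjoint_family_on_def)
        then show ?case using union by simp
      qed
    qed
    then have "AE x in lborel. F x = 0"
      using F by (intro density_unique_real) (auto simp: set_lebesgue_integral_def)
    then show ?thesis by eventually_elim (auto simp: F_def indicator_def)
  qed
  obtain D where D: "countable D" "D \<subseteq> Pow U" "\<And>X. X \<in> D \<Longrightarrow> \<exists>a b. X = cbox a b" "\<Union>D = U"
    using open_countable_Union_open_cbox[OF U] by metis
  have "AE x in lborel. \<forall>X\<in>D. x \<in> X \<longrightarrow> h1 x = 0"
  proof (intro AE_ball_countable' D)
    fix X assume X: "X \<in> D"
    then obtain a b where ab: "X = cbox a b" using D by blast
    have nul: "cbox a b - box a b \<in> null_sets lborel"
      using negligible_frontier_interval[of a b]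
      by (simp add: negligible_iff_null_sets null_sets_completion_iff)
    have "cbox a b \<subseteq> U" using X D(2) ab by blast
    from AE_not_in[OF nul] cell[OF this] show "AE x in lborel. x \<in> X \<longrightarrow> h1 x = 0"
      unfolding ab by eventually_elim auto
  qed
  then have "AE x in lebesgue. \<forall>X\<in>D. x \<in> X \<longrightarrow> h1 x = 0" by (rule AE_completion)
  with h1_eq' show ?thesis
  proof eventually_elim
    case (elim x)
    have "x \<in> U \<Longrightarrow> h1 x = 0" using elim(2) D(4) by blast
    then show ?case using elim(1) by (auto simp: h0_def)
  qed
qed

text \<open>A chosen weak gradient thus has the same \<open>L\<^sup>1\<close> norm as any other, in particular as a classical one.\<close>

lemma weak_gradient_unique:
  fixes g g' :: "'a::euclidean_space \<Rightarrow> 'a"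
  assumes U: "open U" and g: "is_L1_weak_gradient U u g" and g': "is_L1_weak_gradient U u g'"
  shows "AE x in lebesgue. x \<in> U \<longrightarrow> g x = g' x"
proof -
  have int: "set_integrable lebesgue U (\<lambda>x. f x \<bullet> b)" if "is_L1_weak_gradient U u f" for f b
    using integrable_inner_left[of b lebesgue "\<lambda>x. indicator U x *\<^sub>R f x"] that
    by (simp add: is_L1_weak_gradient_def set_integrable_def)
  have int2: "set_integrable lebesgue U (\<lambda>x. (f x \<bullet> b) * \<phi> x)"
    if "is_L1_weak_gradient U u f" and \<phi>: "\<phi> \<in> test_functions U" for f b \<phi>
  proof -
    obtain B where "\<And>x. norm (\<phi> x) \<le> B" using test_functions_bounded[OF \<phi>] by blast
    with integrable_scaleR_bounded[of lebesgue "\<lambda>x. indicator U x * (f x \<bullet> b)" \<phi> B] int[OF that(1), of b]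
    show ?thesis
      using borel_measurable_lebesgue_continuous[OF test_functions_continuous[OF \<phi>]]
      by (simp add: set_integrable_def mult.assoc)
  qed
  have "AE x in lebesgue. \<forall>b\<in>Basis. x \<in> U \<longrightarrow> g x \<bullet> b - g' x \<bullet> b = 0"
  proof (rule AE_ball_countable'[OF _ countable_finite[OF finite_Basis]])
    fix b :: 'a assume b: "b \<in> Basis"
    show "AE x in lebesgue. x \<in> U \<longrightarrow> g x \<bullet> b - g' x \<bullet> b = 0"
    proof (rule fundamental_lemma_of_calculus_of_variations[OF U])
      show "set_integrable lebesgue U (\<lambda>x. g x \<bullet> b - g' x \<bullet> b)"
        using int g g' by (intro set_integral_diff)
      fix \<phi> :: "'a \<Rightarrow> real" assume \<phi>: "\<phi> \<in> test_functions U"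
      have "(LINT x:U|lebesgue. (g x \<bullet> b - g' x \<bullet> b) * \<phi> x) =
          (LINT x:U|lebesgue. (g x \<bullet> b) * \<phi> x) - (LINT x:U|lebesgue. (g' x \<bullet> b) * \<phi> x)"
        unfolding left_diff_distrib by (rule set_integral_diff[OF int2 int2]) (use g g' \<phi> in auto)
      also have "\<dots> = 0"
        using g g' \<phi> b by (auto simp: is_L1_weak_gradient_def)
      finally show "(LINT x:U|lebesgue. (g x \<bullet> b - g' x \<bullet> b) * \<phi> x) = 0" .
    qed
  qed
  then show ?thesis
    by eventually_elim (auto intro: euclidean_eqI)
qed

section \<open>Convolution with a smooth kernel\<close>

text \<open>The shift is in the argument of the kernel \<open>K\<close>, so that derivatives fall on \<open>K\<close> and a merely
continuous density \<open>f\<close> yields a smooth field.\<close>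

definition convolve :: "('a::euclidean_space \<Rightarrow> real) \<Rightarrow> ('a \<Rightarrow> 'b::euclidean_space) \<Rightarrow> 'a \<Rightarrow> 'b" where
  "convolve f K x = (LINT y|lborel. f y *\<^sub>R K (x - y))"

context
  fixes f :: "'a::euclidean_space \<Rightarrow> real"
  assumes cont_f: "continuous_on UNIV f" and supp_f: "bounded {x. f x \<noteq> 0}"
begin

lemma convolve_continuous_kernel:
  fixes K :: "'a \<Rightarrow> 'b::euclidean_space"
  assumes K: "continuous_on UNIV K"
  shows "continuous_on UNIV (\<lambda>y. f y *\<^sub>R K (x - y))"
    and "integrable lborel (\<lambda>y. f y *\<^sub>R K (x - y))"
proof -
  show c: "continuous_on UNIV (\<lambda>y. f y *\<^sub>R K (x - y))"
    by (intro continuous_intros cont_f continuous_on_compose2[OF K]) auto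
  show "integrable lborel (\<lambda>y. f y *\<^sub>R K (x - y))"
    by (rule integrable_continuous_bounded_support(1)[OF c supp_f]) auto
qed

lemma convolve_eq_integral_cbox:
  fixes K :: "'a \<Rightarrow> 'b::euclidean_space"
  assumes K: "continuous_on UNIV K" and ab: "{x. f x \<noteq> 0} \<subseteq> cbox a b"
  shows "convolve f K x = integral (cbox a b) (\<lambda>y. f y *\<^sub>R K (x - y))"
proof -
  have "convolve f K x = integral UNIV (\<lambda>y. f y *\<^sub>R K (x - y))"
    unfolding convolve_def using integral_lborel[OF convolve_continuous_kernel(2)[OF K]] by simp
  also have "(\<lambda>y. f y *\<^sub>R K (x - y)) = (\<lambda>y. if y \<in> cbox a b then f y *\<^sub>R K (x - y) else 0)"
    using ab by (intro ext) auto
  finally show ?thesis by (simp only: integral_restrict_UNIV)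
qed

text \<open>Differentiation under the integral sign over a box that contains the support of \<open>f\<close>.  The derivative
of the kernel is packaged as a bounded linear function, whose continuity can be checked on basis
vectors because the space is finite dimensional.\<close>

lemma convolve_has_derivative:
  fixes K :: "'a \<Rightarrow> 'b::euclidean_space"
  assumes K: "Ck (Suc 0) K"
  shows "(convolve f K has_derivative
    (\<lambda>w. convolve f (\<lambda>z. frechet_derivative K (at z) w) x)) (at x)"
proof -
  obtain a where a: "{x. f x \<noteq> 0} \<subseteq> cbox (- a) a"
    using bounded_subset_cbox_symmetric[OF supp_f] by blast
  have cK: "continuous_on UNIV K" using Ck_imp_continuous_on[OF K] .
  have cDK: "continuous_on UNIV (\<lambda>z. frechet_derivative K (at z) w)" for w
    using K by simp
  define D where "D = (\<lambda>x y. f y *\<^sub>R Blinfun (frechet_derivative K (at (x - y))))"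
  have D: "blinfun_apply (D x y) w = f y *\<^sub>R frechet_derivative K (at (x - y)) w" for x y w
    using has_derivative_bounded_linear[OF Ck_Suc_has_derivative[OF K]]
    by (simp add: D_def scaleR_blinfun.rep_eq bounded_linear_Blinfun_apply)
  have contD: "continuous_on (UNIV \<times> cbox (- a) a) (\<lambda>(x, y). D x y)"
  proof (rule continuous_on_blinfun_componentwise)
    fix w :: 'a
    have "continuous_on (UNIV \<times> cbox (- a) a)
        (\<lambda>p. f (snd p) *\<^sub>R frechet_derivative K (at (fst p - snd p)) w)"
      by (intro continuous_intros continuous_on_compose2[OF cont_f] continuous_on_compose2[OF cDK]) auto
    then show "continuous_on (UNIV \<times> cbox (- a) a) (\<lambda>p. blinfun_apply (case p of (x, y) \<Rightarrow> D x y) w)"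
      by (simp add: D case_prod_unfold)
  qed
  have "((\<lambda>x. integral (cbox (- a) a) (\<lambda>y. f y *\<^sub>R K (x - y))) has_derivative
      blinfun_apply (integral (cbox (- a) a) (D x))) (at x within UNIV)"
  proof (rule leibniz_rule[OF _ _ contD])
    fix x y :: 'a
    have "((\<lambda>x. x - y) has_derivative (\<lambda>w. w)) (at x)"
      by (auto intro!: derivative_eq_intros)
    from has_derivative_compose[where g = K, OF this Ck_Suc_has_derivative[OF K, of "x - y"]]
    have "((\<lambda>x. f y *\<^sub>R K (x - y)) has_derivative
        (\<lambda>w. f y *\<^sub>R frechet_derivative K (at (x - y)) w)) (at x)"
      by (rule has_derivative_scaleR_right)
    also have "(\<lambda>w. f y *\<^sub>R frechet_derivative K (at (x - y)) w) = blinfun_apply (D x y)"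
      by (rule ext) (simp add: D)
    finally show "((\<lambda>x. f y *\<^sub>R K (x - y)) has_derivative blinfun_apply (D x y)) (at x within UNIV)" .
  next
    show "(\<lambda>y. f y *\<^sub>R K (x - y)) integrable_on cbox (- a) a" for x
      by (intro integrable_continuous continuous_on_subset[OF convolve_continuous_kernel(1)[OF cK]]) simp
  qed auto
  moreover have "(\<lambda>x. integral (cbox (- a) a) (\<lambda>y. f y *\<^sub>R K (x - y))) = convolve f K"
    by (intro ext convolve_eq_integral_cbox[symmetric] cK a)
  moreover have "blinfun_apply (integral (cbox (- a) a) (D x)) =
      (\<lambda>w. convolve f (\<lambda>z. frechet_derivative K (at z) w) x)"
  proof (rule ext)
    fix w
    have "continuous_on (cbox (- a) a) (\<lambda>y. case (x, y) of (x, y) \<Rightarrow> D x y)"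
      by (rule continuous_on_compose2[OF contD]) (auto intro!: continuous_intros)
    then have "continuous_on (cbox (- a) a) (D x)" by simp
    then have "D x integrable_on cbox (- a) a" by (rule integrable_continuous)
    then show "blinfun_apply (integral (cbox (- a) a) (D x)) w =
        convolve f (\<lambda>z. frechet_derivative K (at z) w) x"
      by (simp add: blinfun_apply_integral D convolve_eq_integral_cbox[OF cDK a])
  qed
  ultimately show ?thesis by (simp only:)
qed

text \<open>A directional derivative of a convolution is the convolution with the derivative of the kernel, so
the induction runs over all smooth kernels at once.\<close>

lemma Ck_convolve:
  fixes K :: "'a \<Rightarrow> 'b::euclidean_space"
  assumes "\<And>j. Ck j K"
  shows "Ck k (convolve f K)"
  using assms
proof (induction k arbitrary: K)
  case 0
  have "isCont (convolve f K) x" for x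
    using has_derivative_continuous[OF convolve_has_derivative[OF 0]] .
  then show ?case by (simp add: continuous_at_imp_continuous_on)
next
  case (Suc k)
  show ?case
  proof (rule Ck_SucI[OF convolve_has_derivative[OF Suc.prems]])
    fix w
    have "Ck j (\<lambda>z. frechet_derivative K (at z) w)" for j
      using Suc.prems[of "Suc j"] by simp
    then show "Ck k (convolve f (\<lambda>z. frechet_derivative K (at z) w))"
      by (rule Suc.IH)
  qed
qed

lemma divergence_convolve:
  fixes K :: "'a \<Rightarrow> 'a"
  assumes K: "Ck (Suc 0) K"
  shows "divergence (convolve f K) x = convolve f (divergence K) x"
proof -
  have D: "frechet_derivative (convolve f K) (at x) w = convolve f (\<lambda>z. frechet_derivative K (at z) w) x" for w
    using frechet_derivative_at[OF convolve_has_derivative[OF K, of x]] by metis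
  have int: "integrable lborel (\<lambda>y. f y *\<^sub>R frechet_derivative K (at (x - y)) w)" for w
    using convolve_continuous_kernel(2)[of "\<lambda>z. frechet_derivative K (at z) w" x] K by simp
  have "divergence (convolve f K) x =
      (\<Sum>b\<in>Basis. LINT y|lborel. (f y *\<^sub>R frechet_derivative K (at (x - y)) b) \<bullet> b)"
    unfolding divergence_def D convolve_def
    by (intro sum.cong refl integral_inner_left[symmetric] int)
  also have "\<dots> = (LINT y|lborel. (\<Sum>b\<in>Basis. (f y *\<^sub>R frechet_derivative K (at (x - y)) b) \<bullet> b))"
    by (intro Bochner_Integration.integral_sum[symmetric] integrable_inner_left int)
  finally show ?thesis
    by (simp add: convolve_def divergence_def sum_distrib_left)
qed

end

section \<open>The regularized Newtonian kernel\<close>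

lemma lborel_integral_affine:
  fixes g :: "'a::euclidean_space \<Rightarrow> real"
  assumes [measurable]: "g \<in> borel_measurable borel" and c: "c \<noteq> 0"
  shows "(LINT y|lborel. g y) = \<bar>c\<bar> ^ DIM('a) * (LINT z|lborel. g (t + c *\<^sub>R z))"
proof -
  have "(LINT y|lborel. g y) =
      integral\<^sup>L (density (distr lborel borel (\<lambda>x. t + c *\<^sub>R x)) (\<lambda>_. ennreal (\<bar>c\<bar> ^ DIM('a)))) g"
    using lborel_affine[OF c, of t] by simp
  also have "\<dots> = (LINT z|lborel. \<bar>c\<bar> ^ DIM('a) *\<^sub>R g (t + c *\<^sub>R z))"
    by (subst integral_density) (auto simp: integral_distr)
  finally show ?thesis by simp
qed

text \<open>A substitute for integration in polar coordinates: if \<open>g\<close> is at most \<open>c k\<close> on the \<open>k\<close>-th of a family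
of concentric shells that cover its support, then \<open>g\<close> is bounded by the sum of the multiples \<open>c k\<close>
of the indicators of the surrounding balls.  It handles singularities at the center
(radii tending to zero) as well as decay at infinity.\<close>

lemma nn_integral_le_shells:
  fixes g :: "'a::euclidean_space \<Rightarrow> real"
  assumes cover: "\<And>y. g y > 0 \<Longrightarrow> \<exists>k. dist x y < \<rho> k \<and> g y \<le> c k"
    and nonneg: "\<And>k. 0 \<le> c k" "\<And>k. 0 \<le> \<rho> k"
    and sums: "(\<lambda>k. c k * \<rho> k ^ DIM('a)) sums s"
  shows "(\<integral>\<^sup>+y. ennreal (g y) \<partial>lborel) \<le> ennreal (unit_ball_vol (real DIM('a)) * s)"
proof -
  have "(\<integral>\<^sup>+y. ennreal (g y) \<partial>lborel) \<le>
      (\<integral>\<^sup>+y. (\<Sum>k. ennreal (c k) * indicator (ball x (\<rho> k)) y) \<partial>lborel)"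
  proof (rule nn_integral_mono)
    fix y
    show "ennreal (g y) \<le> (\<Sum>k. ennreal (c k) * indicator (ball x (\<rho> k)) y)"
    proof (cases "g y > 0")
      case True
      then obtain k where k: "dist x y < \<rho> k" "g y \<le> c k" using cover by blast
      then have "ennreal (g y) \<le> (\<Sum>i\<in>{k}. ennreal (c i) * indicator (ball x (\<rho> i)) y)"
        by (simp add: ennreal_leI)
      also have "\<dots> \<le> (\<Sum>k. ennreal (c k) * indicator (ball x (\<rho> k)) y)"
        by (rule sum_le_suminf) auto
      finally show ?thesis .
    qed (simp add: ennreal_neg)
  qed
  also have "\<dots> = (\<Sum>k. \<integral>\<^sup>+y. ennreal (c k) * indicator (ball x (\<rho> k)) y \<partial>lborel)"
    by (intro nn_integral_suminf borel_measurable_times_ennreal borel_measurable_const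
        borel_measurable_indicator) simp
  also have "\<dots> = (\<Sum>k. ennreal (unit_ball_vol (real DIM('a)) * (c k * \<rho> k ^ DIM('a))))"
    using nonneg by (intro suminf_cong) (simp add: nn_integral_cmult_indicator emeasure_ball ennreal_mult'[symmetric] mult_ac)
  also have "\<dots> = ennreal (\<Sum>k. unit_ball_vol (real DIM('a)) * (c k * \<rho> k ^ DIM('a)))"
    using nonneg sums by (intro suminf_ennreal2) (auto intro!: mult_nonneg_nonneg summable_mult simp: sums_iff)
  also have "(\<Sum>k. unit_ball_vol (real DIM('a)) * (c k * \<rho> k ^ DIM('a))) = unit_ball_vol (real DIM('a)) * s"
    using sums by (simp add: suminf_mult sums_iff)
  finally show ?thesis .
qed

text \<open>Up to a constant factor, \<open>z / |z|\<^sup>n\<close> is the gradient of the fundamental solution of the Laplacian.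
Replacing \<open>|z|\<^sup>2\<close> by \<open>|z|\<^sup>2 + d\<close> makes it smooth everywhere.\<close>

definition newton_kernel :: "real \<Rightarrow> 'a::euclidean_space \<Rightarrow> 'a" where
  "newton_kernel d z = (z \<bullet> z + d) powr (- real DIM('a) / 2) *\<^sub>R z"

text \<open>The divergence of the regularized kernel.  For \<open>d = \<epsilon>\<^sup>2\<close> it is \<open>\<epsilon>\<^sup>-\<^sup>n \<Phi>(z / \<epsilon>)\<close> with a fixed positive
integrable function \<open>\<Phi>\<close>, hence an approximate identity up to the factor \<open>\<integral>\<Phi>\<close>.\<close>

definition newton_mollifier :: "real \<Rightarrow> 'a::euclidean_space \<Rightarrow> real" where
  "newton_mollifier d z = real DIM('a) * d * (z \<bullet> z + d) powr (- real DIM('a) / 2 - 1)"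

lemma Ck_newton_kernel: "d > 0 \<Longrightarrow> Ck k (newton_kernel d)"
  unfolding newton_kernel_def[abs_def] by (intro Ck_scaleR Ck_inner_self_powr Ck_ident)

lemma continuous_newton_mollifier: "d > 0 \<Longrightarrow> continuous_on UNIV (newton_mollifier d)"
  unfolding newton_mollifier_def[abs_def]
  by (rule Ck_imp_continuous_on[of 0]) (intro Ck_mult Ck_const Ck_inner_self_powr)

lemma divergence_newton_kernel:
  fixes z :: "'a::euclidean_space"
  assumes d: "d > 0"
  shows "divergence (newton_kernel d) z = newton_mollifier d z"
proof -
  define n where "n = real DIM('a)"
  define p where "p = z \<bullet> z + d"
  have p: "p > 0" using d inner_ge_zero[of z] unfolding p_def by linarith
  have "(newton_kernel d has_derivative
      (\<lambda>w. p powr (- n / 2) *\<^sub>R w + (p powr (- n / 2 - 1) * (- n * (z \<bullet> w))) *\<^sub>R z)) (at z)"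
    using has_derivative_scaleR[OF has_derivative_inner_self_powr[OF d, of "- n / 2" z] has_derivative_ident]
    unfolding newton_kernel_def[abs_def] p_def n_def by simp
  then have D: "frechet_derivative (newton_kernel d) (at z) =
      (\<lambda>w. p powr (- n / 2) *\<^sub>R w + (p powr (- n / 2 - 1) * (- n * (z \<bullet> w))) *\<^sub>R z)"
    using frechet_derivative_at by metis
  have "divergence (newton_kernel d) z =
      (\<Sum>b\<in>Basis. p powr (- n / 2) + p powr (- n / 2 - 1) * - n * ((z \<bullet> b) * (z \<bullet> b)))"
    unfolding divergence_def D by (intro sum.cong refl) (simp add: inner_diff_left mult_ac)
  also have "\<dots> = n * p powr (- n / 2) - n * p powr (- n / 2 - 1) * (z \<bullet> z)"
    by (simp add: sum_subtractf n_def sum_distrib_left sum_distrib_right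
        euclidean_inner[of z z] mult_ac)
  also have "p powr (- n / 2) = p * p powr (- n / 2 - 1)"
    using p by (simp add: powr_diff)
  finally have "divergence (newton_kernel d) z = n * (p - z \<bullet> z) * p powr (- n / 2 - 1)"
    by (simp add: algebra_simps)
  then show ?thesis
    by (simp add: newton_mollifier_def p_def n_def)
qed

lemma powr_half_nat:
  assumes "r > 0"
  shows "(r\<^sup>2) powr (- real m / 2) = 1 / r ^ m"
proof -
  have "(r\<^sup>2) powr (- real m / 2) = (r powr 2) powr (- real m / 2)"
    using assms by simp
  also have "\<dots> = r powr (- real m)"
    by (subst powr_powr) simp
  also have "\<dots> = 1 / r ^ m"
    using assms by (simp add: powr_minus powr_realpow divide_inverse)
  finally show ?thesis .
qed

lemma norm_newton_kernel_le:
  fixes z :: "'a::euclidean_space"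
  assumes d: "d > 0" and r: "r > 0" "r \<le> norm z"
  shows "norm (newton_kernel d z) \<le> 1 / r ^ (DIM('a) - 1)"
proof -
  obtain m where m: "DIM('a) = Suc m" using DIM_positive not0_implies_Suc by blast
  have z: "norm z > 0" using r by linarith
  have "norm (newton_kernel d z) = (z \<bullet> z + d) powr (- real DIM('a) / 2) * norm z"
    by (simp add: newton_kernel_def)
  also have "\<dots> \<le> ((norm z)\<^sup>2) powr (- real DIM('a) / 2) * norm z"
    using d z by (intro mult_right_mono powr_mono2') (auto simp: power2_norm_eq_inner)
  also have "\<dots> = 1 / norm z ^ m"
    using z by (simp only: powr_half_nat) (simp add: m)
  also have "\<dots> \<le> 1 / r ^ m"
    using r z by (intro divide_left_mono power_mono) auto
  finally show ?thesis by (simp add: m)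
qed

text \<open>The kernel has size \<open>|z|\<^sup>1\<^sup>-\<^sup>n\<close>.  Its integral over the ball of radius \<open>\<rho>\<close> is at most a multiple of \<open>\<rho>\<close>, by
summation over dyadic shells, and outside this ball it is at most \<open>\<rho>\<^sup>1\<^sup>-\<^sup>n\<close>.  The choice \<open>\<rho>\<^sup>n = |E|\<close> balances
the two parts and bounds the potential of \<open>E\<close> by a multiple of \<open>|E|\<^sup>1\<^sup>/\<^sup>n\<close>, uniformly in \<open>d\<close>.\<close>

lemma newton_potential_bound:
  fixes E :: "'a::euclidean_space set"
  assumes E: "E \<in> lmeasurable" and d: "d > 0" and \<rho>: "\<rho> > 0"
    and f: "continuous_on UNIV f" "\<And>y. 0 \<le> f y" "\<And>y. f y \<le> indicator E y" "bounded {x. f x \<noteq> 0}"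
  shows "norm (convolve f (newton_kernel d) x)
    \<le> unit_ball_vol (real DIM('a)) * (2 ^ DIM('a) * \<rho>) + measure lebesgue E / \<rho> ^ (DIM('a) - 1)"
proof -
  define m where "m = DIM('a) - 1"
  have m: "DIM('a) = Suc m" using DIM_positive[where 'a='a] by (simp add: m_def)
  define g where "g = (\<lambda>y. indicator (ball x \<rho>) y * norm (newton_kernel d (x - y)))"
  have near: "(\<integral>\<^sup>+y. ennreal (g y) \<partial>lborel) \<le> ennreal (unit_ball_vol (real DIM('a)) * (2 ^ DIM('a) * \<rho>))"
  proof (rule nn_integral_le_shells[where \<rho> = "\<lambda>k. \<rho> / 2 ^ k" and c = "\<lambda>k. 1 / (\<rho> / 2 ^ Suc k) ^ m"])
    fix y assume gy: "g y > 0"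
    have "y \<in> ball x \<rho>"
      by (rule ccontr) (use gy in \<open>simp add: g_def\<close>)
    then have y: "dist x y < \<rho>" "x \<noteq> y"
      using gy by (auto simp: g_def newton_kernel_def)
    \<comment> \<open>the first \<open>k\<close> with this property is the index of the dyadic shell that contains \<open>y\<close>\<close>
    define P where "P = (\<lambda>k::nat. \<rho> / 2 ^ Suc k \<le> dist x y)"
    have "\<exists>k. P k"
    proof -
      obtain k where "(1 / 2) ^ k < dist x y / \<rho>"
        using real_arch_pow_inv[of "dist x y / \<rho>" "1/2"] y \<rho> by auto
      then have "\<rho> / 2 ^ k < dist x y" using \<rho> by (simp add: field_simps)
      moreover have "\<rho> / 2 ^ Suc k \<le> \<rho> / 2 ^ k" using \<rho> by (simp add: field_simps)
      ultimately show ?thesis unfolding P_def by (meson less_imp_le order_trans)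
    qed
    then have P: "P (LEAST k. P k)" "\<And>j. j < (LEAST k. P k) \<Longrightarrow> \<not> P j"
      using LeastI_ex not_less_Least by blast+
    define k where "k = (LEAST k. P k)"
    have "dist x y < \<rho> / 2 ^ k"
    proof (cases k)
      case (Suc j)
      then have "\<not> P j" using P(2)[of j] by (simp add: k_def)
      then show ?thesis using Suc by (simp add: P_def)
    qed (use y in simp)
    moreover have "g y \<le> 1 / (\<rho> / 2 ^ Suc k) ^ m"
      using norm_newton_kernel_le[OF d, of "\<rho> / 2 ^ Suc k" "x - y"] P(1)[folded k_def] \<rho> y
      by (simp add: g_def P_def dist_norm m)
    ultimately show "\<exists>k. dist x y < \<rho> / 2 ^ k \<and> g y \<le> 1 / (\<rho> / 2 ^ Suc k) ^ m" by blast
  next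
    have "1 / (\<rho> / 2 ^ Suc k) ^ m * (\<rho> / 2 ^ k) ^ DIM('a) = 2 ^ m * \<rho> * (1 / 2) ^ k" for k
    proof -
      have "(\<rho> / 2 ^ Suc k) ^ m = (\<rho> / 2 ^ k) ^ m / 2 ^ m"
        by (simp add: power_divide power_mult_distrib)
      then show ?thesis using \<rho> by (simp add: m power_divide)
    qed
    moreover have "(\<lambda>k. 2 ^ m * \<rho> * (1 / 2) ^ k) sums (2 ^ m * \<rho> * (1 / (1 - 1 / 2)))"
      by (intro sums_mult geometric_sums) simp
    ultimately show "(\<lambda>k. 1 / (\<rho> / 2 ^ Suc k) ^ m * (\<rho> / 2 ^ k) ^ DIM('a)) sums (2 ^ DIM('a) * \<rho>)"
      by (simp add: m mult_ac)
  qed (use \<rho> in auto)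
  have le: "norm (f y *\<^sub>R newton_kernel d (x - y)) \<le> g y + indicator E y * (1 / \<rho> ^ m)" for y
  proof -
    have "norm (f y *\<^sub>R newton_kernel d (x - y)) \<le> indicator E y * norm (newton_kernel d (x - y))"
      using f(2,3)[of y] by (auto intro: mult_right_mono)
    also have "\<dots> \<le> g y + indicator E y * (1 / \<rho> ^ m)"
    proof (cases "dist x y < \<rho>")
      case False
      then show ?thesis
        using norm_newton_kernel_le[OF d \<rho>, of "x - y"]
        by (auto simp: g_def dist_norm m indicator_def)
    qed (use \<rho> in \<open>auto simp: g_def indicator_def\<close>)
    finally show ?thesis .
  qed
  have K: "continuous_on UNIV (newton_kernel d)"
    using Ck_newton_kernel[OF d] Ck_imp_continuous_on by blast
  have int: "integrable lborel (\<lambda>y. f y *\<^sub>R newton_kernel d (x - y))"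
    by (rule convolve_continuous_kernel(2)[OF f(1,4) K])
  have g_meas [measurable]: "g \<in> borel_measurable borel"
    unfolding g_def
  proof (intro borel_measurable_times borel_measurable_indicator borel_measurable_continuous_onI)
    show "continuous_on UNIV (\<lambda>y. norm (newton_kernel d (x - y)))"
      by (intro continuous_intros continuous_on_compose2[OF K]) auto
  qed simp
  have "ennreal (norm (convolve f (newton_kernel d) x)) \<le>
      (\<integral>\<^sup>+y. ennreal (norm (f y *\<^sub>R newton_kernel d (x - y))) \<partial>lborel)"
    unfolding convolve_def by (rule integral_norm_bound_ennreal[OF int])
  also have "\<dots> = (\<integral>\<^sup>+y. ennreal (norm (f y *\<^sub>R newton_kernel d (x - y))) \<partial>lebesgue)"
    by (rule nn_integral_completion[symmetric])
  also have "\<dots> \<le> (\<integral>\<^sup>+y. ennreal (g y) + ennreal (1 / \<rho> ^ m) * indicator E y \<partial>lebesgue)"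
  proof (rule nn_integral_mono)
    fix y
    have "ennreal (norm (f y *\<^sub>R newton_kernel d (x - y))) \<le> ennreal (g y + indicator E y * (1 / \<rho> ^ m))"
      by (intro ennreal_leI le)
    also have "\<dots> = ennreal (g y) + ennreal (1 / \<rho> ^ m) * indicator E y"
      using \<rho> by (subst ennreal_plus) (auto simp: g_def indicator_def)
    finally show "ennreal (norm (f y *\<^sub>R newton_kernel d (x - y)))
      \<le> ennreal (g y) + ennreal (1 / \<rho> ^ m) * indicator E y" .
  qed
  also have "\<dots> = (\<integral>\<^sup>+y. ennreal (g y) \<partial>lebesgue) + ennreal (1 / \<rho> ^ m) * emeasure lebesgue E"
    using E by (subst nn_integral_add) (auto simp: nn_integral_cmult measurable_completion fmeasurable_def
        intro!: borel_measurable_times_ennreal borel_measurable_indicator)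
  also have "(\<integral>\<^sup>+y. ennreal (g y) \<partial>lebesgue) \<le> ennreal (unit_ball_vol (real DIM('a)) * (2 ^ DIM('a) * \<rho>))"
    using near by (simp add: nn_integral_completion)
  also have "emeasure lebesgue E = ennreal (measure lebesgue E)"
    using E by (simp add: emeasure_eq_measure2)
  finally have "ennreal (norm (convolve f (newton_kernel d) x)) \<le>
      ennreal (unit_ball_vol (real DIM('a)) * (2 ^ DIM('a) * \<rho>)) + ennreal (1 / \<rho> ^ m) * ennreal (measure lebesgue E)"
    by (simp add: add_right_mono)
  also have "\<dots> = ennreal (unit_ball_vol (real DIM('a)) * (2 ^ DIM('a) * \<rho>) + measure lebesgue E / \<rho> ^ m)"
    using \<rho> by (simp add: ennreal_mult'[symmetric] ennreal_plus[symmetric] del: ennreal_plus)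
  finally show ?thesis
    using \<rho> by (subst (asm) ennreal_le_iff) (auto simp: m_def)
qed

text \<open>The function decays like \<open>|z|\<^sup>-\<^sup>n\<^sup>-\<^sup>2\<close>, so the dyadic shells contribute a geometric series of ratio \<open>1/4\<close>.\<close>

lemma integrable_newton_mollifier: "integrable lborel (newton_mollifier 1 :: 'a::euclidean_space \<Rightarrow> real)"
proof (rule integrableI_bounded)
  let ?n = "real DIM('a)"
  show "(newton_mollifier 1 :: 'a \<Rightarrow> real) \<in> borel_measurable lborel"
    using borel_measurable_continuous_onI[OF continuous_newton_mollifier[of 1]] by simp
  have "(\<integral>\<^sup>+(z::'a). ennreal (newton_mollifier 1 z) \<partial>lborel)
      \<le> ennreal (unit_ball_vol ?n * (?n * 2 ^ DIM('a) * (1 / (1 - 1 / 4))))"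
  proof (rule nn_integral_le_shells[where x = 0 and \<rho> = "\<lambda>k. 2 ^ Suc k" and c = "\<lambda>k. ?n / (2 ^ k) ^ (DIM('a) + 2)"])
    fix z :: 'a
    define P where "P = (\<lambda>k::nat. norm z < 2 ^ Suc k)"
    have "\<exists>k. P k"
    proof -
      obtain k where "norm z < 2 ^ k" using real_arch_pow[of 2 "norm z"] by auto
      also have "(2::real) ^ k \<le> 2 ^ Suc k" by simp
      finally show ?thesis unfolding P_def by blast
    qed
    then have P: "P (LEAST k. P k)" "\<And>j. j < (LEAST k. P k) \<Longrightarrow> \<not> P j"
      using LeastI_ex not_less_Least by blast+
    define k where "k = (LEAST k. P k)"
    have "newton_mollifier 1 z \<le> ?n * ((2 ^ k)\<^sup>2) powr (- real (DIM('a) + 2) / 2)"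
    proof -
      have "((2::real) ^ k)\<^sup>2 \<le> z \<bullet> z + 1"
      proof (cases k)
        case (Suc j)
        then have "\<not> P j" using P(2)[of j] by (simp add: k_def)
        then have "2 ^ k \<le> norm z" using Suc by (simp add: P_def)
        then have "((2::real) ^ k)\<^sup>2 \<le> (norm z)\<^sup>2" by (intro power_mono) auto
        then show ?thesis by (simp add: power2_norm_eq_inner)
      qed simp
      then have "(z \<bullet> z + 1) powr (- real (DIM('a) + 2) / 2) \<le> ((2 ^ k)\<^sup>2) powr (- real (DIM('a) + 2) / 2)"
        by (intro powr_mono2') auto
      moreover have "- ?n / 2 - 1 = - real (DIM('a) + 2) / 2" by (simp add: field_simps)
      ultimately show ?thesis
        unfolding newton_mollifier_def by (simp only: mult_1_right) (rule mult_left_mono, auto)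
    qed
    also have "\<dots> = ?n / (2 ^ k) ^ (DIM('a) + 2)"
      by (subst powr_half_nat) auto
    finally show "\<exists>k. dist 0 z < 2 ^ Suc k \<and> newton_mollifier 1 z \<le> ?n / (2 ^ k) ^ (DIM('a) + 2)"
      using P(1)[folded k_def] by (auto simp: P_def)
  next
    have "?n / (2 ^ k) ^ (DIM('a) + 2) * (2 ^ Suc k) ^ DIM('a) = ?n * 2 ^ DIM('a) * (1 / 4) ^ k" for k
    proof -
      have "((2::real) ^ Suc k) ^ DIM('a) = 2 ^ DIM('a) * (2 ^ k) ^ DIM('a)"
        by (simp add: power_mult_distrib)
      moreover have "((2::real) ^ k)\<^sup>2 = 4 ^ k"
        by (simp add: power_mult[symmetric] mult.commute[of k] power_mult[of 2 2])
      ultimately show ?thesis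
        by (simp add: power_add power_divide) (simp add: power2_eq_square)
    qed
    moreover have "(\<lambda>k. ?n * 2 ^ DIM('a) * (1 / 4) ^ k) sums (?n * 2 ^ DIM('a) * (1 / (1 - 1 / 4)))"
      by (intro sums_mult geometric_sums) simp
    ultimately show "(\<lambda>k. ?n / (2 ^ k) ^ (DIM('a) + 2) * (2 ^ Suc k) ^ DIM('a)) sums
        (?n * 2 ^ DIM('a) * (1 / (1 - 1 / 4)))" by simp
  qed auto
  then show "(\<integral>\<^sup>+(z::'a). ennreal (norm (newton_mollifier 1 z)) \<partial>lborel) < \<infinity>"
    by (simp add: newton_mollifier_def order_le_less_trans)
qed

definition newton_mass :: "'a::euclidean_space itself \<Rightarrow> real" where
  "newton_mass _ = (LINT z|lborel. newton_mollifier 1 (z::'a))"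

lemma newton_mass_pos: "newton_mass TYPE('a::euclidean_space) > 0"
proof -
  have pos: "newton_mollifier 1 z > 0" for z :: 'a
  proof -
    have "z \<bullet> z + 1 > 0" using inner_ge_zero[of z] by linarith
    then show ?thesis by (simp add: newton_mollifier_def)
  qed
  have "newton_mass TYPE('a) \<noteq> 0"
  proof
    assume "newton_mass TYPE('a) = 0"
    then have "AE z in lborel. newton_mollifier 1 (z::'a) = 0"
      using integral_nonneg_eq_0_iff_AE[OF integrable_newton_mollifier[where 'a='a]] less_imp_le[OF pos]
      by (simp add: newton_mass_def)
    then have "AE z::'a in lborel. False"
      by eventually_elim (metis pos less_irrefl)
    then have "emeasure lborel (UNIV :: 'a set) = 0"
      by (simp add: AE_iff_measurable[OF _ refl])
    then show False by simp
  qed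
  moreover have "newton_mass TYPE('a) \<ge> 0"
    unfolding newton_mass_def
    by (rule Bochner_Integration.integral_nonneg) (simp add: less_imp_le pos)
  ultimately show ?thesis by simp
qed

lemma convolve_newton_mollifier:
  fixes f :: "'a::euclidean_space \<Rightarrow> real"
  assumes f: "continuous_on UNIV f" and e: "\<epsilon> > 0"
  shows "convolve f (newton_mollifier (\<epsilon>\<^sup>2)) x = (LINT z|lborel. f (x - \<epsilon> *\<^sub>R z) * newton_mollifier 1 z)"
proof -
  have scale: "newton_mollifier (\<epsilon>\<^sup>2) (\<epsilon> *\<^sub>R z) = newton_mollifier 1 z / \<epsilon> ^ DIM('a)" for z :: 'a
  proof -
    have "(\<epsilon>\<^sup>2) powr (- real DIM('a) / 2 - 1) = (\<epsilon>\<^sup>2) powr (- real (DIM('a) + 2) / 2)"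
      by (simp add: field_simps)
    also have "\<dots> = 1 / \<epsilon> ^ (DIM('a) + 2)"
      using e by (rule powr_half_nat)
    finally have *: "(\<epsilon>\<^sup>2) powr (- real DIM('a) / 2 - 1) = 1 / \<epsilon> ^ (DIM('a) + 2)" .
    have "\<epsilon> *\<^sub>R z \<bullet> \<epsilon> *\<^sub>R z + \<epsilon>\<^sup>2 = \<epsilon>\<^sup>2 * (z \<bullet> z + 1)"
      by (simp add: power2_eq_square algebra_simps)
    then have "newton_mollifier (\<epsilon>\<^sup>2) (\<epsilon> *\<^sub>R z) = real DIM('a) * \<epsilon>\<^sup>2 *
        (1 / \<epsilon> ^ (DIM('a) + 2) * (z \<bullet> z + 1) powr (- real DIM('a) / 2 - 1))"
      unfolding newton_mollifier_def *[symmetric] by (simp only: powr_mult)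
    then show ?thesis
      using e by (simp add: newton_mollifier_def power_add power2_eq_square)
  qed
  have "convolve f (newton_mollifier (\<epsilon>\<^sup>2)) x =
      \<bar>- \<epsilon>\<bar> ^ DIM('a) * (LINT z|lborel. f (x + (- \<epsilon>) *\<^sub>R z) * newton_mollifier (\<epsilon>\<^sup>2) (x - (x + (- \<epsilon>) *\<^sub>R z)))"
    unfolding convolve_def real_scaleR_def
  proof (rule lborel_integral_affine)
    show "(\<lambda>y. f y * newton_mollifier (\<epsilon>\<^sup>2) (x - y)) \<in> borel_measurable borel"
      using e by (intro borel_measurable_continuous_onI continuous_on_mult f
          continuous_on_compose2[OF continuous_newton_mollifier]) (auto intro!: continuous_intros)
  qed (use e in auto)
  also have "\<dots> = (LINT z|lborel. f (x - \<epsilon> *\<^sub>R z) * newton_mollifier 1 z)"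
    using e by (simp add: scale)
  finally show ?thesis .
qed

lemma convolve_newton_mollifier_tendsto:
  fixes f :: "'a::euclidean_space \<Rightarrow> real"
  assumes f: "continuous_on UNIV f" "\<And>y. \<bar>f y\<bar> \<le> 1"
    and \<epsilon>: "\<And>k. \<epsilon> k > 0" "\<epsilon> \<longlonglongrightarrow> 0"
  shows "(\<lambda>k. convolve f (newton_mollifier ((\<epsilon> k)\<^sup>2)) x) \<longlonglongrightarrow> newton_mass TYPE('a) * f x"
    and "\<bar>convolve f (newton_mollifier ((\<epsilon> k)\<^sup>2)) x\<bar> \<le> newton_mass TYPE('a)"
proof -
  have nonneg: "newton_mollifier 1 z \<ge> 0" for z :: 'a
    by (simp add: newton_mollifier_def)
  have bound: "\<bar>f (x - \<epsilon> k *\<^sub>R z) * newton_mollifier 1 z\<bar> \<le> newton_mollifier 1 z" for k z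
    using mult_right_mono[OF f(2) nonneg, of "x - \<epsilon> k *\<^sub>R z" z] nonneg[of z] by (simp add: abs_mult)
  have meas: "(\<lambda>z. f (x - \<epsilon> k *\<^sub>R z) * newton_mollifier 1 z) \<in> borel_measurable lborel" for k
    unfolding measurable_lborel2
    by (intro borel_measurable_continuous_onI continuous_on_mult continuous_newton_mollifier
        continuous_on_compose2[OF f(1)]) (auto intro!: continuous_intros)
  have "(\<lambda>k. LINT z|lborel. f (x - \<epsilon> k *\<^sub>R z) * newton_mollifier 1 z) \<longlonglongrightarrow>
      (LINT z|lborel. f x * newton_mollifier 1 (z::'a))"
  proof (rule integral_dominated_convergence)
    show "integrable lborel (newton_mollifier 1 :: 'a \<Rightarrow> real)"
      by (rule integrable_newton_mollifier)
    show "(\<lambda>z. f (x - \<epsilon> k *\<^sub>R z) * newton_mollifier 1 z) \<in> borel_measurable lborel" for k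
      by (rule meas)
    show "(\<lambda>z. f x * newton_mollifier 1 z) \<in> borel_measurable lborel"
      by (intro borel_measurable_integrable integrable_mult_right integrable_newton_mollifier)
    show "AE z in lborel. (\<lambda>k. f (x - \<epsilon> k *\<^sub>R z) * newton_mollifier 1 z) \<longlonglongrightarrow> f x * newton_mollifier 1 z"
    proof (intro AE_I2 tendsto_mult_right)
      fix z
      have "(\<lambda>k. x - \<epsilon> k *\<^sub>R z) \<longlonglongrightarrow> x - 0 *\<^sub>R z" by (intro tendsto_intros \<epsilon>)
      moreover have "isCont f x" using f(1) continuous_on_eq_continuous_at[OF open_UNIV] by blast
      ultimately show "(\<lambda>k. f (x - \<epsilon> k *\<^sub>R z)) \<longlonglongrightarrow> f x"
        using isCont_tendsto_compose by fastforce
    qed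
    show "AE z in lborel. norm (f (x - \<epsilon> k *\<^sub>R z) * newton_mollifier 1 z) \<le> newton_mollifier 1 z" for k
      using bound by simp
  qed
  then show "(\<lambda>k. convolve f (newton_mollifier ((\<epsilon> k)\<^sup>2)) x) \<longlonglongrightarrow> newton_mass TYPE('a) * f x"
    by (simp add: convolve_newton_mollifier[OF f(1) \<epsilon>(1)] newton_mass_def mult.commute)
  have int: "integrable lborel (\<lambda>z. f (x - \<epsilon> k *\<^sub>R z) * newton_mollifier 1 z)"
    by (rule Bochner_Integration.integrable_bound[OF integrable_newton_mollifier meas])
       (use bound nonneg in auto)
  have "\<bar>LINT z|lborel. f (x - \<epsilon> k *\<^sub>R z) * newton_mollifier 1 z\<bar> \<le>
      (LINT z|lborel. \<bar>f (x - \<epsilon> k *\<^sub>R z) * newton_mollifier 1 z\<bar>)"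
    by (rule integral_abs_bound)
  also have "\<dots> \<le> (LINT z|lborel. newton_mollifier 1 (z::'a))"
    by (rule integral_mono[OF integrable_abs[OF int] integrable_newton_mollifier bound])
  finally have "\<bar>LINT z|lborel. f (x - \<epsilon> k *\<^sub>R z) * newton_mollifier 1 z\<bar> \<le>
      (LINT z|lborel. newton_mollifier 1 (z::'a))" .
  then show "\<bar>convolve f (newton_mollifier ((\<epsilon> k)\<^sup>2)) x\<bar> \<le> newton_mass TYPE('a)"
    by (simp add: convolve_newton_mollifier[OF f(1) \<epsilon>(1)] newton_mass_def)
qed

section \<open>A Sobolev inequality for functions of bounded variation\<close>

text \<open>An explicit bell-shaped profile takes the place of the usual plateau: as \<open>k\<close> grows, these functions
increase to \<open>1\<close> pointwise while their gradients tend to zero uniformly.  The factor \<open>exp 1\<close>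
normalizes the value at the origin.\<close>

definition smooth_cutoff :: "nat \<Rightarrow> 'a::euclidean_space \<Rightarrow> real" where
  "smooth_cutoff k x = exp 1 * flat_exp 0 (1 - (x \<bullet> x) / (real (Suc k))\<^sup>2)"

lemma flat_exp_bounded:
  obtains B where "B > 0" "\<And>t. t \<le> 1 \<Longrightarrow> \<bar>flat_exp j t\<bar> \<le> B"
proof -
  have "continuous_on {0..1} (flat_exp j)"
    by (rule continuous_on_subset[OF Ck_imp_continuous_on[OF Ck_flat_exp[of 0 j]]]) simp
  then have "bounded (flat_exp j ` {0..1})"
    by (intro compact_imp_bounded compact_continuous_image) auto
  then obtain B where B: "B > 0" "\<And>t. t \<in> {0..1} \<Longrightarrow> norm (flat_exp j t) \<le> B"
    by (auto simp: bounded_pos)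
  have "\<bar>flat_exp j t\<bar> \<le> B" if "t \<le> 1" for t
    using B(2)[of t] B(1) that by (cases "t \<ge> 0") (auto simp: flat_exp_def)
  with B(1) that show thesis by blast
qed

lemma Ck_smooth_cutoff: "Ck j (smooth_cutoff k :: 'a::euclidean_space \<Rightarrow> real)"
proof -
  have "Ck j (\<lambda>x::'a. 1 + (- 1 / (real (Suc k))\<^sup>2) * (x \<bullet> x))"
    by (intro Ck_add Ck_mult Ck_const Ck_inner_self)
  then have "Ck j (\<lambda>x::'a. 1 - (x \<bullet> x) / (real (Suc k))\<^sup>2)" by (simp add: field_simps)
  then show ?thesis
    unfolding smooth_cutoff_def[abs_def] by (intro Ck_mult Ck_const Ck_compose_real[OF Ck_flat_exp])
qed

lemma smooth_cutoff_bounds: "0 \<le> smooth_cutoff k x" "smooth_cutoff k x \<le> 1"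
proof -
  show "0 \<le> smooth_cutoff k x" by (simp add: smooth_cutoff_def flat_exp_def)
  define t where "t = 1 - (x \<bullet> x) / (real (Suc k))\<^sup>2"
  have t: "t \<le> 1" by (simp add: t_def)
  have "exp 1 * flat_exp 0 t \<le> 1"
  proof (cases "t > 0")
    case True
    then have "1 - 1 / t \<le> 0" using t by (simp add: field_simps)
    then show ?thesis using True by (simp add: flat_exp_def exp_add[symmetric])
  qed (simp add: flat_exp_def)
  then show "smooth_cutoff k x \<le> 1" by (simp add: smooth_cutoff_def t_def)
qed

lemma smooth_cutoff_support: "{x. smooth_cutoff k x \<noteq> 0} \<subseteq> cball 0 (real (Suc k))"
proof
  fix x :: 'a assume "x \<in> {x. smooth_cutoff k x \<noteq> 0}"
  then have "1 - (x \<bullet> x) / (real (Suc k))\<^sup>2 > 0"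
    by (auto simp: smooth_cutoff_def flat_exp_def split: if_splits)
  then have "(norm x)\<^sup>2 < (real (Suc k))\<^sup>2"
    by (simp add: power2_norm_eq_inner[symmetric] field_simps del: of_nat_Suc)
  then have "norm x < real (Suc k)" by (rule power2_less_imp_less) simp
  then show "x \<in> cball 0 (real (Suc k))" by simp
qed

lemma smooth_cutoff_tendsto: "(\<lambda>k. smooth_cutoff k x) \<longlonglongrightarrow> 1"
proof -
  have lim: "(\<lambda>k. 1 - (x \<bullet> x) * (inverse (real (Suc k)))\<^sup>2) \<longlonglongrightarrow> 1 - (x \<bullet> x) * 0\<^sup>2"
    by (intro tendsto_intros LIMSEQ_inverse_real_of_nat)
  have "(\<lambda>k. exp 1 * flat_exp 0 (1 - (x \<bullet> x) * (inverse (real (Suc k)))\<^sup>2)) \<longlonglongrightarrow>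
      exp 1 * flat_exp 0 (1 - (x \<bullet> x) * 0\<^sup>2)"
    by (rule tendsto_mult_left[OF isCont_tendsto_compose[OF
            DERIV_isCont[OF flat_exp_has_real_derivative] lim]])
  then show ?thesis
    by (simp add: smooth_cutoff_def[abs_def] flat_exp_def power_inverse divide_inverse exp_minus)
qed

lemma smooth_cutoff_derivative:
  obtains B where "B > 0"
    "\<And>k x w. \<bar>frechet_derivative (smooth_cutoff k) (at x) w\<bar> \<le> B * norm (w::'a::euclidean_space) / real (Suc k)"
proof -
  obtain B where B: "B > 0" "\<And>t. t \<le> 1 \<Longrightarrow> \<bar>flat_exp 2 t\<bar> \<le> B"
    using flat_exp_bounded by blast
  have main: "\<bar>frechet_derivative (smooth_cutoff k) (at x) w\<bar> \<le> (exp 1 * B * 2) * norm w / real (Suc k)"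
    for k and x w :: 'a
  proof -
    define R where "R = real (Suc k)"
    have R: "R > 0" by (simp add: R_def)
    define t where "t = 1 - (x \<bullet> x) / R\<^sup>2"
    have "((\<lambda>x. 1 - (x \<bullet> x) / R\<^sup>2) has_derivative (\<lambda>w. - (2 * (x \<bullet> w)) / R\<^sup>2)) (at x)"
      using R by (auto intro!: derivative_eq_intros simp: inner_commute field_simps)
    moreover have "(flat_exp 0 has_derivative (\<lambda>s. flat_exp 2 t * s)) (at t)"
      using flat_exp_has_real_derivative[of 0 t] by (simp add: has_field_derivative_def numeral_2_eq_2)
    ultimately have "((\<lambda>x. flat_exp 0 (1 - (x \<bullet> x) / R\<^sup>2)) has_derivative
        (\<lambda>w. flat_exp 2 t * (- (2 * (x \<bullet> w)) / R\<^sup>2))) (at x)"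
      unfolding t_def by (rule has_derivative_compose)
    then have "(smooth_cutoff k has_derivative
        (\<lambda>w. exp 1 * (flat_exp 2 t * (- (2 * (x \<bullet> w)) / R\<^sup>2)))) (at x)"
      unfolding smooth_cutoff_def[abs_def] R_def by (rule has_derivative_mult_right)
    then have D: "frechet_derivative (smooth_cutoff k) (at x) w =
        exp 1 * (flat_exp 2 t * (- (2 * (x \<bullet> w)) / R\<^sup>2))"
      using frechet_derivative_at by metis
    show ?thesis
    proof (cases "t > 0")
      case True
      then have "(norm x)\<^sup>2 < R\<^sup>2"
        using R by (simp add: t_def power2_norm_eq_inner field_simps)
      then have x: "norm x \<le> R" using R power2_less_imp_less less_imp_le by fastforce
      have "\<bar>x \<bullet> w\<bar> \<le> R * norm w"
        using Cauchy_Schwarz_ineq2[of x w] mult_right_mono[OF x norm_ge_zero[of w]] by linarith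
      moreover have "\<bar>flat_exp 2 t\<bar> \<le> B" using B(2) by (simp add: t_def)
      ultimately have "\<bar>flat_exp 2 t\<bar> * \<bar>x \<bullet> w\<bar> \<le> B * (R * norm w)"
        using B(1) by (intro mult_mono) auto
      then have "exp 1 * 2 / R\<^sup>2 * (\<bar>flat_exp 2 t\<bar> * \<bar>x \<bullet> w\<bar>) \<le> exp 1 * 2 / R\<^sup>2 * (B * (R * norm w))"
        by (rule mult_left_mono) simp
      then show ?thesis
        using R unfolding D R_def[symmetric] by (simp add: abs_mult power2_eq_square field_simps)
    next
      case False
      then show ?thesis using B(1) unfolding D by (simp add: flat_exp_def)
    qed
  qed
  show thesis by (rule that[OF _ main]) (use B(1) in simp)
qed

text \<open>The potential \<open>w = K * f\<close> of \<open>f\<close> is a smooth field with \<open>|w| \<le> C |E|\<^sup>1\<^sup>/\<^sup>n\<close>, and its divergence is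
close to a multiple of \<open>f\<close>.  After division by this bound and multiplication with a cutoff it is
admissible in the definition of the total variation.  Dominated convergence, with the cutoff and the
regularization removed simultaneously, gives the claim; the term in which the cutoff is
differentiated disappears because \<open>u\<close> is integrable and \<open>w\<close> is bounded.\<close>

lemma integral_continuous_le_total_variation:
  fixes u f :: "'a::euclidean_space \<Rightarrow> real"
  assumes u: "u \<in> BV UNIV" and E: "E \<in> lmeasurable" "measure lebesgue E > 0"
    and f: "continuous_on UNIV f" "\<And>y. 0 \<le> f y" "\<And>y. f y \<le> indicator E y" "bounded {x. f x \<noteq> 0}"
  shows "newton_mass TYPE('a) * (LINT x|lebesgue. u x * f x) \<le>
    (unit_ball_vol (real DIM('a)) * 2 ^ DIM('a) + 1) * root DIM('a) (measure lebesgue E) *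
      real_of_ereal (total_variation UNIV u)"
proof -
  define M where "M = measure lebesgue E"
  have M: "M > 0" using E by (simp add: M_def)
  define L where "L = (unit_ball_vol (real DIM('a)) * 2 ^ DIM('a) + 1) * root DIM('a) M"
  have L: "L > 0" unfolding L_def using M by (intro mult_pos_pos add_nonneg_pos) auto
  define V where "V = real_of_ereal (total_variation UNIV u)"
  have f1: "\<bar>f y\<bar> \<le> 1" for y
    using f(2,3)[of y] by (cases "y \<in> E") auto
  have iu: "integrable lebesgue u"
    using u by (simp add: BV_def set_integrable_def)
  define \<epsilon> where "\<epsilon> = (\<lambda>k. inverse (real (Suc k)))"
  have \<epsilon>: "\<epsilon> k > 0" "\<epsilon> \<longlonglongrightarrow> 0" for k
    using LIMSEQ_inverse_real_of_nat by (auto simp: \<epsilon>_def)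
  define w where "w = (\<lambda>k. convolve f (newton_kernel ((\<epsilon> k)\<^sup>2)))"
  have Ck_w: "Ck j (w k)" for j k
    unfolding w_def by (rule Ck_convolve[OF f(1,4)]) (use \<epsilon>(1)[of k] in \<open>auto intro: Ck_newton_kernel\<close>)
  have norm_w: "norm (w k x) \<le> L" for k x
  proof -
    define r where "r = root DIM('a) M"
    have r: "r > 0" using M by (simp add: r_def)
    have "r ^ DIM('a) = M" using M by (simp add: r_def)
    then have "M / r ^ (DIM('a) - 1) = r"
      using r power_minus_mult[of "DIM('a)" r] by (simp add: field_simps)
    then show ?thesis
      using newton_potential_bound[OF E(1), of "(\<epsilon> k)\<^sup>2" r f x] \<epsilon>(1)[of k] r f
      by (simp add: w_def L_def r_def[symmetric] M_def[symmetric] algebra_simps)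
  qed
  define v where "v = (\<lambda>k x. (smooth_cutoff k x / L) *\<^sub>R w k x)"
  have v_test: "v k \<in> test_functions UNIV" for k
  proof (rule test_functionsI)
    show "Ck j (v k)" for j
      unfolding v_def divide_inverse by (intro Ck_scaleR Ck_mult Ck_smooth_cutoff Ck_const Ck_w)
    show "{x. v k x \<noteq> 0} \<subseteq> cball 0 (real (Suc k))"
      using smooth_cutoff_support[of k, where 'a='a] by (auto simp: v_def)
  qed auto
  have v_norm: "norm (v k x) \<le> 1" for k x
  proof -
    have "smooth_cutoff k x * norm (w k x) \<le> 1 * L"
      using smooth_cutoff_bounds[of k x] norm_w[of k x] L by (intro mult_mono) auto
    then show ?thesis using L smooth_cutoff_bounds[of k x] by (simp add: v_def abs_mult)
  qed
  define D where "D = (\<lambda>k x. frechet_derivative (smooth_cutoff k) (at x) (w k x))"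
  define m where "m = (\<lambda>k. convolve f (newton_mollifier ((\<epsilon> k)\<^sup>2)))"
  have div_v: "divergence (v k) x = (smooth_cutoff k x * m k x + D k x) / L" for k x
  proof -
    let ?\<chi>' = "frechet_derivative (smooth_cutoff k) (at x)"
    let ?w' = "frechet_derivative (w k) (at x)"
    have \<chi>': "(smooth_cutoff k has_derivative ?\<chi>') (at x)"
      by (rule Ck_Suc_has_derivative[OF Ck_smooth_cutoff])
    have "(v k has_derivative (\<lambda>h. (smooth_cutoff k x / L) *\<^sub>R ?w' h + (?\<chi>' h / L) *\<^sub>R w k x)) (at x)"
      unfolding v_def
      by (rule has_derivative_scaleR[OF bounded_linear.has_derivative[OF bounded_linear_divide \<chi>']
            Ck_Suc_has_derivative[OF Ck_w]])
    then have "frechet_derivative (v k) (at x) =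
        (\<lambda>h. (smooth_cutoff k x / L) *\<^sub>R ?w' h + (?\<chi>' h / L) *\<^sub>R w k x)"
      using frechet_derivative_at by metis
    then have "divergence (v k) x =
        (\<Sum>b\<in>Basis. (smooth_cutoff k x / L) * (?w' b \<bullet> b) + (?\<chi>' b / L) * (w k x \<bullet> b))"
      unfolding divergence_def by (simp add: inner_add_left)
    also have "\<dots> = (smooth_cutoff k x * divergence (w k) x + (\<Sum>b\<in>Basis. (w k x \<bullet> b) * ?\<chi>' b)) / L"
      by (simp add: sum.distrib sum_distrib_left sum_divide_distrib add_divide_distrib divergence_def mult_ac)
    also have "(\<Sum>b\<in>Basis. (w k x \<bullet> b) * ?\<chi>' b) = ?\<chi>' (\<Sum>b\<in>Basis. (w k x \<bullet> b) *\<^sub>R b)"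
      using bounded_linear.linear[OF has_derivative_bounded_linear[OF \<chi>']]
      by (simp add: linear_sum linear_scale)
    also have "\<dots> = D k x" by (simp add: D_def euclidean_representation)
    also have "divergence (w k) x = m k x"
    proof -
      have e: "(\<epsilon> k)\<^sup>2 > 0" using \<epsilon>(1)[of k] by simp
      have "divergence (newton_kernel ((\<epsilon> k)\<^sup>2) :: 'a \<Rightarrow> 'a) = newton_mollifier ((\<epsilon> k)\<^sup>2)"
        by (rule ext) (rule divergence_newton_kernel[OF e])
      then show ?thesis
        using divergence_convolve[OF f(1,4) Ck_newton_kernel[OF e]] by (simp add: w_def m_def)
    qed
    finally show ?thesis .
  qed
  obtain B where B: "B > 0"
    "\<And>k x h. \<bar>frechet_derivative (smooth_cutoff k) (at x) h\<bar> \<le> B * norm (h::'a) / real (Suc k)"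
    using smooth_cutoff_derivative by blast
  have D_le: "\<bar>D k x\<bar> \<le> B * L * inverse (real (Suc k))" for k x
  proof -
    have "\<bar>D k x\<bar> \<le> B * norm (w k x) / real (Suc k)" unfolding D_def by (rule B(2))
    also have "\<dots> \<le> B * L / real (Suc k)"
      using B(1) norm_w[of k x] by (intro divide_right_mono mult_left_mono) auto
    finally show ?thesis by (simp add: divide_inverse)
  qed
  have m_le: "\<bar>m k x\<bar> \<le> newton_mass TYPE('a)" for k x
    unfolding m_def by (rule convolve_newton_mollifier_tendsto(2)[OF f(1) f1 \<epsilon>])
  have TV: "(LINT x|lebesgue. u x * divergence (v k) x) \<le> V" for k
  proof -
    have "ereal (LINT x:UNIV|lebesgue. u x * divergence (v k) x) \<le> total_variation UNIV u"
      unfolding total_variation_def by (rule SUP_upper) (use v_test v_norm in auto)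
    moreover have "total_variation UNIV u < \<infinity>" using u by (simp add: BV_def)
    ultimately show ?thesis
      by (cases "total_variation UNIV u") (auto simp: V_def set_lebesgue_integral_def)
  qed
  have "(\<lambda>k. LINT x|lebesgue. u x * divergence (v k) x) \<longlonglongrightarrow>
      (LINT x|lebesgue. u x * (newton_mass TYPE('a) * f x / L))"
  proof (rule integral_dominated_convergence)
    show "integrable lebesgue (\<lambda>x. \<bar>u x\<bar> * ((newton_mass TYPE('a) + B * L) / L))"
      using iu by simp
    have "(\<lambda>x. divergence (v k) x) \<in> borel_measurable lebesgue" for k
      unfolding divergence_def
      by (intro borel_measurable_sum borel_measurable_inner borel_measurable_const
          borel_measurable_lebesgue_continuous test_functions_derivative_continuous[OF v_test])
    then show "(\<lambda>x. u x * divergence (v k) x) \<in> borel_measurable lebesgue" for k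
      using iu by simp
    show "(\<lambda>x. u x * (newton_mass TYPE('a) * f x / L)) \<in> borel_measurable lebesgue"
      using iu borel_measurable_lebesgue_continuous[OF f(1)] by simp
    show "AE x in lebesgue. norm (u x * divergence (v k) x) \<le> \<bar>u x\<bar> * ((newton_mass TYPE('a) + B * L) / L)" for k
    proof (rule AE_I2)
      fix x
      have "\<bar>smooth_cutoff k x * m k x\<bar> \<le> 1 * newton_mass TYPE('a)"
        unfolding abs_mult using smooth_cutoff_bounds[of k x] m_le[of k x] by (intro mult_mono) auto
      moreover have "\<bar>D k x\<bar> \<le> B * L"
      proof -
        have "inverse (real (Suc k)) \<le> 1" by (simp add: inverse_le_1_iff)
        then have "B * L * inverse (real (Suc k)) \<le> B * L * 1"
          using B(1) L by (intro mult_left_mono) auto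
        then show ?thesis using D_le[of k x] by linarith
      qed
      ultimately have "\<bar>smooth_cutoff k x * m k x + D k x\<bar> \<le> newton_mass TYPE('a) + B * L"
        by linarith
      then have "\<bar>divergence (v k) x\<bar> \<le> (newton_mass TYPE('a) + B * L) / L"
        using L by (simp add: div_v divide_right_mono)
      then show "norm (u x * divergence (v k) x) \<le> \<bar>u x\<bar> * ((newton_mass TYPE('a) + B * L) / L)"
        unfolding real_norm_def abs_mult by (rule mult_left_mono) simp
    qed
    show "AE x in lebesgue. (\<lambda>k. u x * divergence (v k) x) \<longlonglongrightarrow> u x * (newton_mass TYPE('a) * f x / L)"
    proof (rule AE_I2)
      fix x
      have "(\<lambda>k. B * L * inverse (real (Suc k))) \<longlonglongrightarrow> B * L * 0"
        by (intro tendsto_intros LIMSEQ_inverse_real_of_nat)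
      then have "(\<lambda>k. D k x) \<longlonglongrightarrow> 0"
        by (intro Lim_null_comparison[of "\<lambda>k. D k x" "\<lambda>k. B * L * inverse (real (Suc k))"])
           (use D_le in auto)
      moreover have "(\<lambda>k. m k x) \<longlonglongrightarrow> newton_mass TYPE('a) * f x"
        unfolding m_def by (rule convolve_newton_mollifier_tendsto(1)[OF f(1) f1 \<epsilon>])
      ultimately have "(\<lambda>k. u x * ((smooth_cutoff k x * m k x + D k x) / L)) \<longlonglongrightarrow>
          u x * ((1 * (newton_mass TYPE('a) * f x) + 0) / L)"
        using L by (intro tendsto_intros smooth_cutoff_tendsto) auto
      then show "(\<lambda>k. u x * divergence (v k) x) \<longlonglongrightarrow> u x * (newton_mass TYPE('a) * f x / L)"
        by (simp add: div_v)
    qed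
  qed
  then have "(LINT x|lebesgue. u x * (newton_mass TYPE('a) * f x / L)) \<le> V"
    by (rule LIMSEQ_le_const2) (use TV in auto)
  also have "(\<lambda>x. u x * (newton_mass TYPE('a) * f x / L)) = (\<lambda>x. newton_mass TYPE('a) / L * (u x * f x))"
    by (simp add: fun_eq_iff)
  finally have "newton_mass TYPE('a) / L * (LINT x|lebesgue. u x * f x) \<le> V" by simp
  then have "newton_mass TYPE('a) * (LINT x|lebesgue. u x * f x) \<le> L * V"
    using L by (simp add: field_simps)
  then show ?thesis
    unfolding L_def M_def V_def .
qed

text \<open>For \<open>u = 1\<close> on \<open>E\<close> this is the case needed below of the Gagliardo--Nirenberg--Sobolev inequality,
\<open>|E|\<^sup>1\<^sup>-\<^sup>1\<^sup>/\<^sup>n \<le> C \<parallel>Du\<parallel>\<close>.  It follows by duality: exhaust the open set \<open>E\<close> by continuous functions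
\<open>f \<le> 1\<close> that vanish outside \<open>E\<close>, for which \<open>\<integral>f \<le> \<integral>u f\<close>.\<close>

lemma isoperimetric_BV:
  fixes u :: "'a::euclidean_space \<Rightarrow> real"
  assumes u: "u \<in> BV UNIV" and E: "open E" "bounded E" "E \<noteq> {}"
    and u1: "AE x in lebesgue. x \<in> E \<longrightarrow> u x \<ge> 1"
  shows "newton_mass TYPE('a) * measure lebesgue E \<le>
    (unit_ball_vol (real DIM('a)) * 2 ^ DIM('a) + 1) * root DIM('a) (measure lebesgue E) *
      real_of_ereal (total_variation UNIV u)"
proof -
  have E_meas: "E \<in> lmeasurable" using E by (intro lmeasurable_open)
  have E_pos: "measure lebesgue E > 0"
  proof -
    obtain x e where "e > 0" "ball x e \<subseteq> E" using E by (meson equals0I openE)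
    then have "measure lebesgue (ball x e) \<le> measure lebesgue E"
      using E_meas by (intro measure_mono_fmeasurable) auto
    moreover have "measure lebesgue (ball x e) > 0"
      using \<open>e > 0\<close> by simp
    ultimately show ?thesis by linarith
  qed
  define f where "f = (\<lambda>k x. min 1 (real k * infdist x (- E)))"
  have "E \<noteq> UNIV" using E(2) not_bounded_UNIV by blast
  then have compl: "- E \<noteq> {}" by auto
  have f_cont: "continuous_on UNIV (f k)" for k
    unfolding f_def by (intro continuous_intros)
  have f0: "f k x = 0" if "x \<notin> E" for k x
    using that by (simp add: f_def)
  have f_bounds: "0 \<le> f k x" "f k x \<le> indicator E x" for k x
    using f0[of x k] by (auto simp: f_def indicator_def infdist_nonneg)
  have f_lim: "(\<lambda>k. f k x) \<longlonglongrightarrow> indicator E x" for x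
  proof (cases "x \<in> E")
    case True
    then have pos: "infdist x (- E) > 0"
      using E(1) compl by (simp add: infdist_pos_not_in_closed closed_Compl)
    obtain N :: nat where N: "1 / infdist x (- E) \<le> real N" using real_arch_simple by blast
    have "f k x = 1" if "k \<ge> N" for k
    proof -
      have "1 / infdist x (- E) \<le> real k" using N that by linarith
      then show ?thesis using pos by (simp add: f_def field_simps)
    qed
    then have "eventually (\<lambda>k. f k x = 1) sequentially" by (auto simp: eventually_sequentially)
    then show ?thesis using True by (simp add: tendsto_eventually)
  qed (simp add: f0)
  have f_supp: "bounded {x. f k x \<noteq> 0}" for k
    by (rule bounded_subset[OF E(2)]) (use f0 in auto)
  have f_int: "integrable lebesgue (f k)" for k
    by (rule integrable_continuous_bounded_support(2)[OF f_cont f_supp]) auto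
  have iu: "integrable lebesgue u"
    using u by (simp add: BV_def set_integrable_def)
  define V where "V = (unit_ball_vol (real DIM('a)) * 2 ^ DIM('a) + 1) * root DIM('a) (measure lebesgue E) *
      real_of_ereal (total_variation UNIV u)"
  have le: "newton_mass TYPE('a) * (LINT x|lebesgue. f k x) \<le> V" for k
  proof -
    have fb: "norm (f k x) \<le> 1" for x by (simp add: f_def infdist_nonneg)
    have "(LINT x|lebesgue. f k x) \<le> (LINT x|lebesgue. u x * f k x)"
    proof (rule integral_mono_AE[OF f_int])
      show "integrable lebesgue (\<lambda>x. u x * f k x)"
        using integrable_scaleR_bounded[OF iu borel_measurable_lebesgue_continuous[OF f_cont] fb] by simp
      show "AE x in lebesgue. f k x \<le> u x * f k x"
        using u1
      proof eventually_elim
        case (elim x)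
        then show ?case
          using f0[of x k] mult_right_mono[of 1 "u x" "f k x"] f_bounds(1)[of k x] by (cases "x \<in> E") auto
      qed
    qed
    then have "newton_mass TYPE('a) * (LINT x|lebesgue. f k x) \<le> newton_mass TYPE('a) * (LINT x|lebesgue. u x * f k x)"
      using newton_mass_pos[where 'a='a] by (intro mult_left_mono) auto
    also have "\<dots> \<le> V"
      unfolding V_def
      by (rule integral_continuous_le_total_variation[OF u E_meas E_pos f_cont f_bounds f_supp])
    finally show ?thesis .
  qed
  have "(\<lambda>k. LINT x|lebesgue. f k x) \<longlonglongrightarrow> (LINT x|lebesgue. indicator E x)"
  proof (rule integral_dominated_convergence)
    show "integrable lebesgue (indicat_real E)"
      using E_meas by (intro integrable_real_indicator) (auto simp: fmeasurable_def)
    show "AE x in lebesgue. norm (f k x) \<le> indicat_real E x" for k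
      using f_bounds by simp
  qed (use f_lim f_int E_meas in \<open>auto simp: fmeasurable_def\<close>)
  then have "(\<lambda>k. newton_mass TYPE('a) * (LINT x|lebesgue. f k x)) \<longlonglongrightarrow> newton_mass TYPE('a) * measure lebesgue E"
    using E_meas by (intro tendsto_mult_left) (simp add: fmeasurable_def)
  then have "newton_mass TYPE('a) * measure lebesgue E \<le> V"
    by (rule LIMSEQ_le_const2) (use le in auto)
  then show ?thesis by (simp add: V_def)
qed

section \<open>Norms and extension operators\<close>

lemma total_variation_nonneg: "total_variation U u \<ge> 0"
proof -
  have "(\<lambda>x. 0) \<in> test_functions U"
    by (rule test_functionsI[of _ "{}"]) (auto intro: Ck_const)
  then have "ereal (LINT x:U|lebesgue. u x * divergence (\<lambda>x. 0) x) \<le> total_variation U u"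
    unfolding total_variation_def by (intro SUP_upper) auto
  then show ?thesis by (simp add: divergence_def zero_ereal_def)
qed

lemma L1_norm_nonneg: "L1_norm U f \<ge> 0"
  unfolding L1_norm_def set_lebesgue_integral_def
  by (rule Bochner_Integration.integral_nonneg) simp

lemma L1_norm_le_measure:
  fixes f :: "'a::euclidean_space \<Rightarrow> 'b::euclidean_space"
  assumes U: "open U" and f: "f \<in> borel_measurable lebesgue"
    and bound: "\<And>y. norm (f y) \<le> B" and supp: "\<And>y. y \<notin> ball x t \<Longrightarrow> f y = 0"
  shows "f absolutely_integrable_on U" and "L1_norm U f \<le> B * measure lebesgue (ball x t \<inter> U)"
proof -
  have meas: "ball x t \<inter> U \<in> lmeasurable"
    using U by (intro lmeasurable_open bounded_Int) auto
  have int: "integrable lebesgue (\<lambda>y. B * indicat_real (ball x t \<inter> U) y)"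
    using meas by (intro integrable_mult_right integrable_real_indicator) (auto simp: fmeasurable_def)
  have le: "norm (indicat_real U y *\<^sub>R f y) \<le> B * indicat_real (ball x t \<inter> U) y" for y
    using bound[of y] supp[of y] by (cases "y \<in> U"; cases "y \<in> ball x t") auto
  have fU: "(\<lambda>y. indicat_real U y *\<^sub>R f y) \<in> borel_measurable lebesgue"
    using f U by (intro borel_measurable_scaleR borel_measurable_indicator) auto
  show "f absolutely_integrable_on U"
    unfolding set_integrable_def
    by (rule Bochner_Integration.integrable_bound[OF int fU]) (intro AE_I2 order_trans[OF le], simp)
  then have "integrable lebesgue (\<lambda>y. norm (indicat_real U y *\<^sub>R f y))"
    unfolding set_integrable_def by (rule integrable_norm)
  then have "(LINT y|lebesgue. norm (indicat_real U y *\<^sub>R f y)) \<le>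
      (LINT y|lebesgue. B * indicat_real (ball x t \<inter> U) y)"
    by (rule integral_mono[OF _ int le])
  also have "\<dots> = B * measure lebesgue (ball x t \<inter> U)"
    using meas by (simp add: fmeasurable_def)
  finally show "L1_norm U f \<le> B * measure lebesgue (ball x t \<inter> U)"
    by (simp add: L1_norm_def set_lebesgue_integral_def)
qed

lemma W11_subset_BV:
  assumes "u \<in> W11 U"
  shows "u \<in> BV U" and "real_of_ereal (total_variation U u) \<le> L1_norm U (weak_gradient U u)"
proof -
  have u: "u absolutely_integrable_on U" using assms by (simp add: W11_def)
  have "is_L1_weak_gradient U u (weak_gradient U u)"
    using assms someI_ex[of "is_L1_weak_gradient U u"] by (simp add: W11_def weak_gradient_def)
  then have le: "total_variation U u \<le> ereal (L1_norm U (weak_gradient U u))"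
    by (rule total_variation_le_weak_gradient[OF u])
  then show "u \<in> BV U"
    using u by (auto simp: BV_def order_le_less_trans)
  show "real_of_ereal (total_variation U u) \<le> L1_norm U (weak_gradient U u)"
    using real_of_ereal_positive_mono[OF total_variation_nonneg le] by simp
qed

lemma W11_norm_eq:
  assumes U: "open U" and g: "is_L1_weak_gradient U u g"
  shows "W11_norm U u = L1_norm U u + L1_norm U g"
proof -
  have w: "is_L1_weak_gradient U u (weak_gradient U u)"
    using someI[of "is_L1_weak_gradient U u", OF g] by (simp add: weak_gradient_def)
  have meas: "(\<lambda>x. indicat_real U x *\<^sub>R norm (f x)) \<in> borel_measurable lebesgue"
    if "is_L1_weak_gradient U u f" for f
  proof -
    have "integrable lebesgue (\<lambda>x. norm (indicat_real U x *\<^sub>R f x))"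
      using that by (intro integrable_norm) (simp add: is_L1_weak_gradient_def set_integrable_def)
    then show ?thesis by simp
  qed
  have "L1_norm U (weak_gradient U u) = L1_norm U g"
    unfolding L1_norm_def set_lebesgue_integral_def
  proof (rule integral_cong_AE[OF meas[OF w] meas[OF g]])
    show "AE x in lebesgue. indicat_real U x *\<^sub>R norm (weak_gradient U u x) = indicat_real U x *\<^sub>R norm (g x)"
      using weak_gradient_unique[OF U w g] by eventually_elim (auto simp: indicator_def)
  qed
  then show ?thesis by (simp add: W11_norm_def)
qed

text \<open>The inequality passes to the infimum of the admissible constants because, for each fixed \<open>u\<close>, it is
closed in the constant.\<close>

lemma extension_norm_bound:
  assumes T: "extension_operator X N \<Omega> T" and u: "u \<in> X \<Omega>" and nonneg: "N \<Omega> u \<ge> 0"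
  shows "N UNIV (T u) \<le> extension_norm X N \<Omega> T * N \<Omega> u"
proof -
  define S where "S = {C. extension_bound X N \<Omega> T C}"
  have S: "S \<noteq> {}" using T by (auto simp: S_def extension_operator_def)
  have bound: "N UNIV (T u) \<le> C * N \<Omega> u" if "C \<in> S" for C
    using that u by (auto simp: S_def extension_bound_def)
  show ?thesis
  proof (cases "N \<Omega> u = 0")
    case False
    then have pos: "N \<Omega> u > 0" using nonneg by simp
    have "N UNIV (T u) / N \<Omega> u \<le> Inf S"
      by (rule cInf_greatest[OF S]) (use bound pos in \<open>simp add: divide_le_eq\<close>)
    then show ?thesis using pos by (simp add: extension_norm_def S_def divide_le_eq)
  qed (use S bound in fastforce)
qed

section \<open>Radial bump functions\<close>

text \<open>A function that is at least \<open>1\<close> on the ball of radius \<open>s\<close> and vanishes outside the ball of radius \<open>t\<close>.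
A lower bound by \<open>1\<close> serves as well as the value \<open>1\<close>, and the square of the positive part of a quadratic
polynomial is already continuously differentiable, which makes its classical gradient a weak one.\<close>

definition radial_bump :: "real \<Rightarrow> real \<Rightarrow> 'a::euclidean_space \<Rightarrow> 'a \<Rightarrow> real" where
  "radial_bump s t x y = (max 0 ((t\<^sup>2 - (norm (y - x))\<^sup>2) / (t\<^sup>2 - s\<^sup>2)))\<^sup>2"

definition radial_bump_gradient :: "real \<Rightarrow> real \<Rightarrow> 'a::euclidean_space \<Rightarrow> 'a \<Rightarrow> 'a" where
  "radial_bump_gradient s t x y =
    (2 * max 0 ((t\<^sup>2 - (norm (y - x))\<^sup>2) / (t\<^sup>2 - s\<^sup>2)) * (- 2 / (t\<^sup>2 - s\<^sup>2))) *\<^sub>R (y - x)"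

lemma has_real_derivative_square_positive_part:
  "((\<lambda>\<tau>. (max 0 \<tau>)\<^sup>2) has_real_derivative 2 * max 0 \<tau>) (at (\<tau>::real))"
proof -
  consider "\<tau> > 0" | "\<tau> < 0" | "\<tau> = 0" by linarith
  then show ?thesis
  proof cases
    case 1
    have "((\<lambda>\<tau>. \<tau>\<^sup>2) has_real_derivative 2 * max 0 \<tau>) (at \<tau>)"
      using 1 by (auto intro!: derivative_eq_intros)
    then show ?thesis
      by (rule has_field_derivative_transform_within_open[where S = "{0<..}"]) (use 1 in auto)
  next
    case 2
    have "((\<lambda>\<tau>. 0) has_real_derivative 2 * max 0 \<tau>) (at \<tau>)"
      using 2 by simp
    then show ?thesis
      by (rule has_field_derivative_transform_within_open[where S = "{..<0}"]) (use 2 in auto)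
  next
    case 3
    have "((\<lambda>h::real. (max 0 h)\<^sup>2 / h) \<longlongrightarrow> 0) (at 0)"
    proof (rule Lim_null_comparison[where g = "\<lambda>h. \<bar>h\<bar>"])
      show "\<forall>\<^sub>F h in at 0. norm ((max 0 h)\<^sup>2 / h) \<le> \<bar>h::real\<bar>"
        by (auto intro!: always_eventually simp: max_def power2_eq_square)
      show "((\<lambda>h. \<bar>h::real\<bar>) \<longlongrightarrow> 0) (at 0)"
        by (rule tendsto_rabs_zero) (rule tendsto_ident_at)
    qed
    then show ?thesis using 3 by (simp add: has_field_derivative_iff)
  qed
qed

context
  fixes s t :: real and x :: "'a::euclidean_space"
  assumes s: "0 \<le> s" and st: "s < t" and t: "t \<le> 1"
begin

lemma radial_bump_has_derivative:
  "(radial_bump s t x has_derivative (\<lambda>w. radial_bump_gradient s t x y \<bullet> w)) (at y)"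
proof -
  define d where "d = t\<^sup>2 - s\<^sup>2"
  have "((\<lambda>y. (t\<^sup>2 - (y - x) \<bullet> (y - x)) / d) has_derivative (\<lambda>w. (- 2 / d) * ((y - x) \<bullet> w))) (at y)"
    unfolding divide_inverse by (auto intro!: derivative_eq_intros simp: inner_commute algebra_simps)
  from has_derivative_compose[OF this
      has_real_derivative_square_positive_part[unfolded has_field_derivative_def]]
  have "((\<lambda>y. (max 0 ((t\<^sup>2 - (y - x) \<bullet> (y - x)) / d))\<^sup>2) has_derivative
      (\<lambda>w. 2 * max 0 ((t\<^sup>2 - (y - x) \<bullet> (y - x)) / d) * ((- 2 / d) * ((y - x) \<bullet> w)))) (at y)" .
  then show ?thesis
    by (simp add: radial_bump_def[abs_def] radial_bump_gradient_def d_def power2_norm_eq_inner mult.assoc)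
qed

lemma continuous_radial_bump: "continuous_on UNIV (radial_bump s t x)"
  and continuous_radial_bump_gradient: "continuous_on UNIV (radial_bump_gradient s t x)"
  unfolding radial_bump_def[abs_def] radial_bump_gradient_def[abs_def] divide_inverse
  by (intro continuous_intros)+

lemma radial_bump_profile:
  shows "(t\<^sup>2 - (norm (y - x))\<^sup>2) / (t\<^sup>2 - s\<^sup>2) \<le> t / (t - s)"
    and "y \<notin> ball x t \<Longrightarrow> (t\<^sup>2 - (norm (y - x))\<^sup>2) / (t\<^sup>2 - s\<^sup>2) \<le> 0"
    and "y \<in> ball x s \<Longrightarrow> 1 \<le> (t\<^sup>2 - (norm (y - x))\<^sup>2) / (t\<^sup>2 - s\<^sup>2)"
    and "t * (t - s) \<le> t\<^sup>2 - s\<^sup>2" and "0 < t\<^sup>2 - s\<^sup>2"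
proof -
  have tpos: "t > 0" using s st by linarith
  have fact: "t\<^sup>2 - s\<^sup>2 = (t + s) * (t - s)" by (simp add: power2_eq_square algebra_simps)
  show le: "t * (t - s) \<le> t\<^sup>2 - s\<^sup>2"
    unfolding fact using s st by (intro mult_right_mono) auto
  have "0 < t * (t - s)" using tpos st by simp
  then show pos: "0 < t\<^sup>2 - s\<^sup>2" using le by linarith
  have "(t\<^sup>2 - (norm (y - x))\<^sup>2) / (t\<^sup>2 - s\<^sup>2) \<le> t\<^sup>2 / (t\<^sup>2 - s\<^sup>2)"
    using pos by (intro divide_right_mono) auto
  also have "\<dots> \<le> t\<^sup>2 / (t * (t - s))"
    using le \<open>0 < t * (t - s)\<close> by (intro divide_left_mono) auto
  also have "\<dots> = t / (t - s)" using tpos by (simp add: power2_eq_square)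
  finally show "(t\<^sup>2 - (norm (y - x))\<^sup>2) / (t\<^sup>2 - s\<^sup>2) \<le> t / (t - s)" .
  show "(t\<^sup>2 - (norm (y - x))\<^sup>2) / (t\<^sup>2 - s\<^sup>2) \<le> 0" if "y \<notin> ball x t"
  proof -
    have "t \<le> norm (y - x)" using that by (simp add: dist_norm norm_minus_commute)
    then have "t\<^sup>2 \<le> (norm (y - x))\<^sup>2" using tpos by (intro power_mono) auto
    then show ?thesis using pos by (simp add: divide_nonpos_pos)
  qed
  show "1 \<le> (t\<^sup>2 - (norm (y - x))\<^sup>2) / (t\<^sup>2 - s\<^sup>2)" if "y \<in> ball x s"
  proof -
    have "norm (y - x) \<le> s" using that by (simp add: dist_norm norm_minus_commute)
    then have "(norm (y - x))\<^sup>2 \<le> s\<^sup>2" by (intro power_mono) auto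
    then show ?thesis using pos by (simp add: le_divide_eq)
  qed
qed

lemma radial_bump_ge_1: "y \<in> ball x s \<Longrightarrow> radial_bump s t x y \<ge> 1"
  using radial_bump_profile(3)[of y] unfolding radial_bump_def by (intro one_le_power) linarith

lemma radial_bump_support:
  assumes "y \<notin> ball x t"
  shows "radial_bump s t x y = 0" "radial_bump_gradient s t x y = 0"
  using radial_bump_profile(2)[OF assms] by (auto simp: radial_bump_def radial_bump_gradient_def max_absorb1)

lemma radial_bump_le: "norm (radial_bump s t x y) \<le> t / (t - s)\<^sup>2"
proof -
  have tpos: "t > 0" using s st by linarith
  have "max 0 ((t\<^sup>2 - (norm (y - x))\<^sup>2) / (t\<^sup>2 - s\<^sup>2)) \<le> t / (t - s)"
    using radial_bump_profile(1)[of y] tpos st by simp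
  then have "radial_bump s t x y \<le> (t / (t - s))\<^sup>2"
    unfolding radial_bump_def by (intro power_mono) auto
  also have "\<dots> = t * t / (t - s)\<^sup>2" by (simp add: power_divide power2_eq_square)
  also have "\<dots> \<le> t * 1 / (t - s)\<^sup>2"
    using t tpos by (intro divide_right_mono mult_left_mono) auto
  finally show ?thesis by (simp add: radial_bump_def)
qed

lemma radial_bump_gradient_le: "norm (radial_bump_gradient s t x y) \<le> 4 * t / (t - s)\<^sup>2"
proof (cases "y \<in> ball x t")
  case True
  have tpos: "t > 0" using s st by linarith
  have "norm (radial_bump_gradient s t x y) =
      2 * max 0 ((t\<^sup>2 - (norm (y - x))\<^sup>2) / (t\<^sup>2 - s\<^sup>2)) * (2 / (t\<^sup>2 - s\<^sup>2)) * norm (y - x)"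
    using radial_bump_profile(5) by (simp add: radial_bump_gradient_def abs_mult)
  also have "\<dots> \<le> 2 * (t / (t - s)) * (2 / (t * (t - s))) * t"
    using radial_bump_profile(1)[of y] radial_bump_profile(4,5) tpos st True
    by (intro mult_mono divide_left_mono) (auto simp: dist_norm norm_minus_commute)
  also have "\<dots> = 4 * t / (t - s)\<^sup>2"
    using tpos by (simp add: power2_eq_square)
  finally show ?thesis .
next
  case False
  have "t > 0" using s st by linarith
  then show ?thesis by (simp add: radial_bump_support[OF False])
qed

lemma radial_bump_in_space:
  assumes \<Omega>: "open \<Omega>" and XN: "X = BV \<and> N = BV_norm \<or> X = W11 \<and> N = W11_norm"
  shows "radial_bump s t x \<in> X \<Omega>" and "0 \<le> N \<Omega> (radial_bump s t x)"
    and "N \<Omega> (radial_bump s t x) \<le> 5 * t / (t - s)\<^sup>2 * measure lebesgue (ball x t \<inter> \<Omega>)"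
proof -
  define u where "u = radial_bump s t x"
  define g where "g = radial_bump_gradient s t x"
  define m where "m = measure lebesgue (ball x t \<inter> \<Omega>)"
  have u_int: "u absolutely_integrable_on \<Omega>" "L1_norm \<Omega> u \<le> t / (t - s)\<^sup>2 * m"
    unfolding u_def m_def
    by (rule L1_norm_le_measure[OF \<Omega> borel_measurable_lebesgue_continuous[OF continuous_radial_bump]
          radial_bump_le], erule radial_bump_support(1))+
  have g_int: "g absolutely_integrable_on \<Omega>" "L1_norm \<Omega> g \<le> 4 * t / (t - s)\<^sup>2 * m"
    unfolding g_def m_def
    by (rule L1_norm_le_measure[OF \<Omega> borel_measurable_lebesgue_continuous[OF continuous_radial_bump_gradient]
          radial_bump_gradient_le], erule radial_bump_support(2))+
  have weak: "is_L1_weak_gradient \<Omega> u g"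
    unfolding u_def g_def
    by (rule is_L1_weak_gradient_C1[OF radial_bump_has_derivative continuous_radial_bump_gradient])
       (use g_int(1) in \<open>simp add: g_def\<close>)
  have W: "u \<in> W11 \<Omega>" using weak u_int(1) by (auto simp: W11_def)
  have "total_variation \<Omega> u \<le> ereal (L1_norm \<Omega> g)"
    by (rule total_variation_le_weak_gradient[OF u_int(1) weak])
  then have TV: "real_of_ereal (total_variation \<Omega> u) \<le> L1_norm \<Omega> g"
    using real_of_ereal_positive_mono[OF total_variation_nonneg] by fastforce
  show "radial_bump s t x \<in> X \<Omega>"
    using XN W W11_subset_BV(1)[OF W] by (auto simp: u_def)
  show "0 \<le> N \<Omega> (radial_bump s t x)"
    using XN by (auto simp: BV_norm_def W11_norm_def intro!: add_nonneg_nonneg L1_norm_nonneg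
        real_of_ereal_pos total_variation_nonneg)
  have "N \<Omega> u \<le> L1_norm \<Omega> u + L1_norm \<Omega> g"
    using XN W11_norm_eq[OF \<Omega> weak] TV by (auto simp: BV_norm_def)
  also have "\<dots> \<le> t / (t - s)\<^sup>2 * m + 4 * t / (t - s)\<^sup>2 * m"
    using u_int(2) g_int(2) by (rule add_mono)
  also have "\<dots> = 5 * t / (t - s)\<^sup>2 * m"
    by (simp add: algebra_simps add_divide_distrib[symmetric])
  finally show "N \<Omega> (radial_bump s t x) \<le> 5 * t / (t - s)\<^sup>2 * measure lebesgue (ball x t \<inter> \<Omega>)"
    by (simp add: u_def m_def)
qed

end

section \<open>Measure density of extension domains\<close>

definition isoperimetric_const :: "'a::euclidean_space itself \<Rightarrow> real" where
  "isoperimetric_const _ = (unit_ball_vol (real DIM('a)) * 2 ^ DIM('a) + 1) / newton_mass TYPE('a)"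

lemma isoperimetric_const_pos: "isoperimetric_const TYPE('a::euclidean_space) > 0"
  unfolding isoperimetric_const_def
  by (intro divide_pos_pos newton_mass_pos add_nonneg_pos) auto

text \<open>The Sobolev inequality is applied to the extension of a radial bump function.  Its variation on
the whole space is controlled by the norm of the bump function on \<open>\<Omega>\<close>, and this norm only sees
the part of the larger ball that lies in \<open>\<Omega>\<close>.\<close>

lemma extension_growth:
  fixes x :: "'a::euclidean_space"
  assumes XN: "X = BV \<and> N = BV_norm \<or> X = W11 \<and> N = W11_norm"
    and \<Omega>: "open \<Omega>" and T: "extension_operator X N \<Omega> T"
    and s: "0 \<le> s" "s < t" "t \<le> 1" and E: "ball x s \<inter> \<Omega> \<noteq> {}"
  shows "measure lebesgue (ball x s \<inter> \<Omega>) \<le>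
    isoperimetric_const TYPE('a) * root DIM('a) (measure lebesgue (ball x s \<inter> \<Omega>)) *
      (max 1 (extension_norm X N \<Omega> T) * (5 * t / (t - s)\<^sup>2 * measure lebesgue (ball x t \<inter> \<Omega>)))"
proof -
  define u where "u = radial_bump s t x"
  define K where "K = extension_norm X N \<Omega> T"
  define E where "E = ball x s \<inter> \<Omega>"
  note u = radial_bump_in_space[OF s \<Omega> XN, of x, folded u_def]
  have Tu: "T u \<in> X UNIV" "AE y in lebesgue. y \<in> \<Omega> \<longrightarrow> T u y = u y"
    using T u(1) by (auto simp: extension_operator_def)
  have Tu_BV: "T u \<in> BV UNIV" and TV_le: "real_of_ereal (total_variation UNIV (T u)) \<le> N UNIV (T u)"
    using XN Tu(1) W11_subset_BV[of "T u" UNIV] L1_norm_nonneg[of UNIV "T u"]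
    by (auto simp: BV_norm_def W11_norm_def)
  have "AE y in lebesgue. y \<in> E \<longrightarrow> T u y \<ge> 1"
    using Tu(2) by eventually_elim (use radial_bump_ge_1[OF s, of _ x] in \<open>auto simp: E_def u_def\<close>)
  then have iso: "newton_mass TYPE('a) * measure lebesgue E \<le>
      (unit_ball_vol (real DIM('a)) * 2 ^ DIM('a) + 1) * root DIM('a) (measure lebesgue E) *
        real_of_ereal (total_variation UNIV (T u))"
    using \<Omega> E by (intro isoperimetric_BV[OF Tu_BV]) (auto simp: E_def intro: bounded_Int)
  have "N UNIV (T u) \<le> K * N \<Omega> u"
    unfolding K_def by (rule extension_norm_bound[where X = X and N = N, OF T u(1,2)])
  also have "\<dots> \<le> max 1 K * (5 * t / (t - s)\<^sup>2 * measure lebesgue (ball x t \<inter> \<Omega>))"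
    using u(2,3) by (intro mult_mono) auto
  finally have "real_of_ereal (total_variation UNIV (T u)) \<le>
      max 1 K * (5 * t / (t - s)\<^sup>2 * measure lebesgue (ball x t \<inter> \<Omega>))"
    using TV_le by linarith
  moreover have "measure lebesgue E \<le> isoperimetric_const TYPE('a) * root DIM('a) (measure lebesgue E) *
      real_of_ereal (total_variation UNIV (T u))"
    using iso newton_mass_pos[where 'a='a] by (simp add: isoperimetric_const_def field_simps)
  moreover have "0 \<le> isoperimetric_const TYPE('a) * root DIM('a) (measure lebesgue E)"
    using isoperimetric_const_pos[where 'a='a] by simp
  ultimately show ?thesis
    unfolding E_def[symmetric] K_def[symmetric] by (meson mult_left_mono order_trans)
qed

text \<open>With \<open>n = p + 1\<close> the hypothesis reads \<open>m(s)\<^sup>1\<^sup>-\<^sup>1\<^sup>/\<^sup>n \<le> Q t (t - s)\<^sup>-\<^sup>2 m(t)\<close>: the exponent on the left is less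
than one, so the inequality is superlinear.  Along radii that decrease from \<open>r\<close> to \<open>r / 2\<close> with
gaps \<open>r / 2\<^sup>k\<^sup>+\<^sup>2\<close> it makes \<open>m\<close> decay geometrically as soon as \<open>m(r) / r\<^sup>n\<close> is below a threshold.
Then \<open>m (r / 2)\<close> would be zero.\<close>

lemma de_giorgi_iteration:
  fixes m :: "real \<Rightarrow> real"
  assumes p: "p \<ge> 1" and Q: "Q > 0" and r: "r > 0"
    and pos: "\<And>s. 0 < s \<Longrightarrow> m s > 0" and mono: "\<And>s t. s \<le> t \<Longrightarrow> m s \<le> m t"
    and growth: "\<And>s t. 0 < s \<Longrightarrow> s < t \<Longrightarrow> t \<le> r \<Longrightarrow>
      m s \<le> root (Suc p) (m s) * (Q * (t / (t - s)\<^sup>2 * m t))"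
  shows "m r \<ge> (1 / (16 * Q * 4 ^ p)) ^ Suc p * r ^ Suc p"
proof (rule ccontr)
  define \<delta> where "\<delta> = 1 / (16 * Q * 4 ^ p)"
  have \<delta>: "\<delta> > 0" using Q by (simp add: \<delta>_def)
  assume "\<not> m r \<ge> (1 / (16 * Q * 4 ^ p)) ^ Suc p * r ^ Suc p"
  then have small: "m r < (\<delta> * r) ^ Suc p"
    unfolding \<delta>_def[symmetric] power_mult_distrib by simp
  define \<rho> where "\<rho> = (\<lambda>k::nat. r * (1 / 2 + 1 / 2 ^ Suc k))"
  \<comment> \<open>scale-invariant quantities: \<open>m (\<rho> k) = (b k * r)\<^sup>n\<close>\<close>
  define b where "b = (\<lambda>k. root (Suc p) (m (\<rho> k)) / r)"
  have \<rho>: "\<rho> k \<ge> r / 2" "\<rho> k \<le> r" for k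
    using r by (auto simp: \<rho>_def field_simps)
  have \<rho>_pos: "\<rho> k > 0" for k using \<rho>(1)[of k] r by linarith
  have b_pos: "b k > 0" for k using pos[OF \<rho>_pos] r by (simp add: b_def)
  have m_b: "m (\<rho> k) = (b k * r) ^ Suc p" for k
    using pos[OF \<rho>_pos, of k] r by (simp add: b_def less_imp_le del: power_Suc)
  have step: "b (Suc k) ^ p \<le> 16 * Q * 4 ^ k * b k ^ Suc p" for k
  proof -
    have diff: "\<rho> k - \<rho> (Suc k) = r / (4 * 2 ^ k)"
      using r by (simp add: \<rho>_def field_simps)
    have lt: "\<rho> (Suc k) < \<rho> k" using diff r by (smt (verit) divide_pos_pos zero_less_power mult_pos_pos)
    have "\<rho> k / (\<rho> k - \<rho> (Suc k))\<^sup>2 \<le> r / (\<rho> k - \<rho> (Suc k))\<^sup>2"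
      by (intro divide_right_mono \<rho>(2)) simp
    also have "\<dots> = 16 * 4 ^ k / r"
    proof -
      have "(r / (4 * 2 ^ k))\<^sup>2 = r\<^sup>2 / (16 * 4 ^ k)"
        by (simp add: power_divide power_mult_distrib power_mult[symmetric] mult.commute[of k] power_mult[of 2 2])
      then show ?thesis unfolding diff using r by (simp add: power2_eq_square)
    qed
    finally have frac: "\<rho> k / (\<rho> k - \<rho> (Suc k))\<^sup>2 \<le> 16 * 4 ^ k / r" .
    have root_eq: "root (Suc p) (m (\<rho> (Suc k))) = b (Suc k) * r"
      using r by (simp add: b_def)
    have br: "b (Suc k) * r > 0" using b_pos r by simp
    have "(b (Suc k) * r) * (b (Suc k) * r) ^ p \<le>
        (b (Suc k) * r) * (Q * (\<rho> k / (\<rho> k - \<rho> (Suc k))\<^sup>2 * m (\<rho> k)))"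
      using growth[OF \<rho>_pos lt \<rho>(2)] unfolding root_eq by (simp add: m_b[of "Suc k"])
    then have "(b (Suc k) * r) ^ p \<le> Q * (\<rho> k / (\<rho> k - \<rho> (Suc k))\<^sup>2 * m (\<rho> k))"
      using br by (simp only: mult_le_cancel_left_pos)
    also have "\<dots> \<le> Q * (16 * 4 ^ k / r * m (\<rho> k))"
      using Q pos[OF \<rho>_pos, of k] by (intro mult_left_mono mult_right_mono frac) auto
    also have "\<dots> = r ^ p * (16 * Q * 4 ^ k * b k ^ Suc p)"
      using r by (simp add: m_b power_mult_distrib)
    also have "(b (Suc k) * r) ^ p = r ^ p * b (Suc k) ^ p"
      by (simp add: power_mult_distrib)
    finally have "r ^ p * b (Suc k) ^ p \<le> r ^ p * (16 * Q * 4 ^ k * b k ^ Suc p)" .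
    then show ?thesis using r by simp
  qed
  \<comment> \<open>the threshold \<open>\<delta>\<close> is chosen such that the rate \<open>1/4\<close> cancels the growth \<open>4 ^ k\<close> of the coefficients\<close>
  have decay: "b k \<le> \<delta> * (1 / 4) ^ k" for k
  proof (induction k)
    case 0
    have "\<rho> 0 = r" by (simp add: \<rho>_def)
    then have "m r = (b 0 * r) ^ Suc p" using m_b[of 0] by (simp only:)
    then have "(b 0 * r) ^ Suc p < (\<delta> * r) ^ Suc p" using small by (simp only:)
    then have "b 0 * r < \<delta> * r" by (rule power_less_imp_less_base) (use \<delta> r in simp)
    then show ?case using r by simp
  next
    case (Suc k)
    have "b (Suc k) ^ p \<le> 16 * Q * 4 ^ k * b k ^ Suc p" by (rule step)
    also have "\<dots> \<le> 16 * Q * 4 ^ k * (\<delta> * (1 / 4) ^ k) ^ Suc p"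
      using Q b_pos[of k] Suc by (intro mult_left_mono power_mono) auto
    also have "\<dots> = (16 * Q * \<delta>) * (\<delta> * (1 / 4) ^ k) ^ p"
      by (simp add: power_one_over field_simps)
    also have "16 * Q * \<delta> = (1 / 4) ^ p"
      using Q by (simp add: \<delta>_def power_one_over)
    also have "(1 / 4) ^ p * (\<delta> * (1 / 4) ^ k) ^ p = (\<delta> * (1 / 4) ^ Suc k) ^ p"
      by (simp add: power_mult_distrib[symmetric] mult_ac)
    finally show ?case
      using p \<delta> b_pos[of "Suc k"] by (simp add: power_mono_iff)
  qed
  define \<beta> where "\<beta> = root (Suc p) (m (r / 2)) / r"
  have \<beta>: "\<beta> > 0" using pos[of "r / 2"] r by (simp add: \<beta>_def)
  have "\<beta> \<le> b k" for k
    unfolding \<beta>_def b_def using r mono[OF \<rho>(1)] by (intro divide_right_mono) auto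
  then have "\<beta> \<le> \<delta> * (1 / 4) ^ k" for k using decay[of k] by (meson order_trans)
  moreover have "(\<lambda>k. \<delta> * (1 / 4) ^ k) \<longlonglongrightarrow> \<delta> * 0"
    by (intro tendsto_mult_left LIMSEQ_realpow_zero) auto
  ultimately have "\<beta> \<le> 0" by (intro LIMSEQ_le_const[where X = "\<lambda>k. \<delta> * (1 / 4) ^ k"]) auto
  with \<beta> show False by simp
qed

lemma extension_domain_measure_density:
  fixes \<Omega> :: "'a::euclidean_space set"
  assumes dim: "DIM('a) \<ge> 2"
    and XN: "X = BV \<and> N = BV_norm \<or> X = W11 \<and> N = W11_norm"
    and \<Omega>: "open \<Omega>" and T: "extension_operator X N \<Omega> T"
    and x: "x \<in> closure \<Omega>" and r: "0 < r" "r \<le> 1"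
  shows "(1 / (16 * (5 * isoperimetric_const TYPE('a) * max 1 (extension_norm X N \<Omega> T)) * 4 ^ (DIM('a) - 1))) ^ DIM('a)
      * r ^ DIM('a) \<le> measure lebesgue (ball x r \<inter> \<Omega>)"
proof -
  define p where "p = DIM('a) - 1"
  have p: "DIM('a) = Suc p" "p \<ge> 1" using dim by (auto simp: p_def)
  define m where "m = (\<lambda>s. measure lebesgue (ball x s \<inter> \<Omega>))"
  define C where "C = isoperimetric_const TYPE('a)"
  define K where "K = max 1 (extension_norm X N \<Omega> T)"
  have meas: "ball x s \<inter> \<Omega> \<in> lmeasurable" for s
    using \<Omega> by (intro lmeasurable_open bounded_Int) auto
  have ne: "ball x s \<inter> \<Omega> \<noteq> {}" if s: "s > 0" for s
  proof -
    obtain y where "y \<in> \<Omega>" "dist y x < s" using x s unfolding closure_approachable by blast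
    then have "y \<in> ball x s \<inter> \<Omega>" by (simp add: dist_commute)
    then show ?thesis by blast
  qed
  have "m r \<ge> (1 / (16 * (5 * C * K) * 4 ^ p)) ^ Suc p * r ^ Suc p"
  proof (rule de_giorgi_iteration[OF p(2) _ r(1)])
    show "5 * C * K > 0"
      using isoperimetric_const_pos[where 'a='a] by (simp add: C_def K_def)
    show "m s > 0" if s: "0 < s" for s
    proof -
      have "open (ball x s \<inter> \<Omega>)" using \<Omega> by auto
      then have "\<not> negligible (ball x s \<inter> \<Omega>)" using ne[OF s] open_not_negligible by blast
      then show ?thesis
        using meas[of s] by (simp add: m_def negligible_iff_measure zero_less_measure_iff)
    qed
    show "m s \<le> m t" if "s \<le> t" for s t
      unfolding m_def using that meas by (intro measure_mono_fmeasurable) (auto simp: fmeasurableD)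
    show "m s \<le> root (Suc p) (m s) * (5 * C * K * (t / (t - s)\<^sup>2 * m t))"
      if "0 < s" "s < t" "t \<le> r" for s t
      using extension_growth[OF XN \<Omega> T, of s t x] that r ne[of s]
      by (simp add: m_def C_def K_def p(1) mult_ac)
  qed
  then show ?thesis by (simp add: m_def C_def K_def p(1))
qed

theorem proposition2p3:
  assumes "CARD('n::finite) \<ge> 2"
  shows "\<exists>c :: real \<Rightarrow> real. (\<forall>K. c K > 0) \<and>
    (\<forall>X N. (X = BV \<and> N = BV_norm \<or> X = W11 \<and> N = W11_norm) \<longrightarrow>
      (\<forall>(\<Omega> :: (real ^ 'n) set) T.
         extension_domain X N \<Omega> \<and> extension_operator X N \<Omega> T \<longrightarrow>
         (\<forall>x \<in> closure \<Omega>. \<forall>r \<in> {0<..1}.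
            measure lebesgue (ball x r \<inter> \<Omega>) \<ge> c (extension_norm X N \<Omega> T) * r ^ CARD('n))))"
proof -
  define c where "c = (\<lambda>K. (1 / (16 * (5 * isoperimetric_const TYPE(real ^ 'n) * max 1 K) * 4 ^ (CARD('n) - 1))) ^ CARD('n))"
  have dim: "DIM(real ^ 'n) = CARD('n)" by simp
  show ?thesis
  proof (intro exI[of _ c] conjI allI impI ballI)
    show "c K > 0" for K
      using isoperimetric_const_pos[where 'a="real ^ 'n"] by (simp add: c_def)
  next
    fix X N and \<Omega> :: "(real ^ 'n) set" and T x r
    assume XN: "X = BV \<and> N = BV_norm \<or> X = W11 \<and> N = W11_norm"
      and ext: "extension_domain X N \<Omega> \<and> extension_operator X N \<Omega> T"
      and x: "x \<in> closure \<Omega>" and r: "r \<in> {0<..1::real}"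
    show "c (extension_norm X N \<Omega> T) * r ^ CARD('n) \<le> measure lebesgue (ball x r \<inter> \<Omega>)"
      using extension_domain_measure_density[OF _ XN _ _ x, of T r] assms ext r
      unfolding c_def dim by (auto simp: extension_domain_def)
  qed
qed

end
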